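(* Let $(M,\xi,\eta,\Phi,g)$ be a compact quasi-regular Sasakian $\eta$-Einstein manifold of dimension $2n+1$, with $\mathrm{Ric}_g=\lambda g+\nu\,\eta\otimes\eta$ and $\lambda<-2$. Then $M$ admits a Lorentzian Sasakian-Einstein structure $(\xi',g')$ such that $$\xi'=a^{-1}\xi,\qquad -g'=ag+a(a-1)\eta\otimes\eta,\qquad\text{where } a=\frac{\lambda+2}{2+2n}.$$
   Context: A Sasakian structure $(\xi,\eta,\Phi,g)$ on a manifold $M$ of dimension $2n+1$ consists of a vector field $\xi$, a 1-form $\eta$, a $(1,1)$-tensor field $\Phi$ and a Riemannian metric $g$ with $\eta(\xi)=1$, $\Phi^2X=-X+\eta(X)\xi$, $g(\Phi X,\Phi Y)=g(X,Y)-\eta(X)\eta(Y)$, such that $\eta$ is a contact form and the metric cone over $(M,g)$ is Kähler; equivalently $(\nabla_X\Phi)Y=g(X,Y)\xi-\eta(Y)X$. It is $\eta$-Einstein if $\mathrm{Ric}_g=\lambda g+\nu\,\eta\otimes\eta$ for real constants $\lambda,\nu$. It is quasi-regular if there is a positive integer $k$ such that each point has a foliated chart $U$ for the foliation generated by $\xi$ such that each leaf passes through $U$ at most $k$ times. A Lorentzian Sasakian structure on a manifold of dimension $2n+1$ is a Lorentzian metric $g$ with a time-like Killing vector field $\xi$, $g(\xi,\xi)=-1$, such that $\Phi(X)=\nabla_X\xi$ satisfies $(\nabla_X\Phi)(Y)=g(X,Y)\xi-g(Y,\xi)X$; it is Lorentzian Sasakian-Einstein if in addition $g$ is Einstein (the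 Einstein constant is then $-2n$). *)

theory Defs
  imports "HOL-Analysis.Analysis"
begin

section \<open>Smooth maps between Euclidean spaces\<close>

text \<open>Meaningful for open \<open>S\<close>: all iterated directional derivatives of order below \<open>k\<close> are
  (totally) differentiable and those of order \<open>k\<close> are continuous.\<close>

primrec Ck_on :: "nat \<Rightarrow> 'v::real_normed_vector set \<Rightarrow> ('v \<Rightarrow> 'w::real_normed_vector) \<Rightarrow> bool" where
  "Ck_on 0 S f \<longleftrightarrow> continuous_on S f"
| "Ck_on (Suc k) S f \<longleftrightarrow>
     (\<forall>x\<in>S. f differentiable (at x)) \<and> (\<forall>v. Ck_on k S (\<lambda>x. frechet_derivative f (at x) v))"

definition smooth_on :: "'v::real_normed_vector set \<Rightarrow> ('v \<Rightarrow> 'w::real_normed_vector) \<Rightarrow> bool" where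
  "smooth_on S f \<longleftrightarrow> (\<forall>k. Ck_on k S f)"

definition pd :: "'m \<Rightarrow> (real^'m::finite \<Rightarrow> 'w::real_normed_vector) \<Rightarrow> real^'m \<Rightarrow> 'w" where
  "pd i f x = frechet_derivative f (at x) (axis i 1)"


section \<open>Smooth manifolds\<close>

text \<open>A chart is a pair of a domain \<open>U\<close> and a coordinate map \<open>\<phi>\<close>; the values of \<open>\<phi>\<close> outside
  \<open>U\<close> are junk.  The dimension is \<open>CARD('m)\<close>.\<close>

type_synonym ('a, 'm) chart = "'a set \<times> ('a \<Rightarrow> real^'m)"

abbreviation cdom :: "('a, 'm::finite) chart \<Rightarrow> 'a set" where "cdom c \<equiv> fst c"
abbreviation cmap :: "('a, 'm::finite) chart \<Rightarrow> 'a \<Rightarrow> real^'m" where "cmap c \<equiv> snd c"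

definition crange :: "('a, 'm::finite) chart \<Rightarrow> (real^'m) set" where
  "crange c = cmap c ` cdom c"

definition is_chart :: "'a topology \<Rightarrow> ('a, 'm::finite) chart \<Rightarrow> bool" where
  "is_chart M c \<longleftrightarrow> openin M (cdom c) \<and> open (crange c) \<and>
     homeomorphic_map (subtopology M (cdom c)) (top_of_set (crange c)) (cmap c)"

definition overlap :: "('a, 'm::finite) chart \<Rightarrow> ('a, 'm) chart \<Rightarrow> (real^'m) set" where
  "overlap c d = cmap c ` (cdom c \<inter> cdom d)"

definition transition :: "('a, 'm::finite) chart \<Rightarrow> ('a, 'm) chart \<Rightarrow> real^'m \<Rightarrow> real^'m" where
  "transition c d = cmap d \<circ> inv_into (cdom c) (cmap c)"

definition jacobian :: "('a, 'm::finite) chart \<Rightarrow> ('a, 'm) chart \<Rightarrow> real^'m \<Rightarrow> real^'m^'m" where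
  "jacobian c d x = matrix (frechet_derivative (transition c d) (at x))"

definition compatible :: "('a, 'm::finite) chart \<Rightarrow> ('a, 'm) chart \<Rightarrow> bool" where
  "compatible c d \<longleftrightarrow>
     smooth_on (overlap c d) (transition c d) \<and> smooth_on (overlap d c) (transition d c)"

text \<open>The smooth structure is given by its maximal atlas.\<close>

definition smooth_manifold :: "'a topology \<Rightarrow> ('a, 'm::finite) chart set \<Rightarrow> bool" where
  "smooth_manifold M A \<longleftrightarrow>
     Hausdorff_space M \<and> second_countable M \<and>
     (\<forall>c\<in>A. is_chart M c) \<and> (\<Union>c\<in>A. cdom c) = topspace M \<and>
     (\<forall>c\<in>A. \<forall>d\<in>A. compatible c d) \<and>
     (\<forall>c. is_chart M c \<and> (\<forall>d\<in>A. compatible c d) \<longrightarrow> c \<in> A)"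


section \<open>Tensor fields\<close>

text \<open>A tensor field assigns to every chart \<open>c\<close> of the atlas its smooth components, as a function of
  the coordinates \<open>x \<in> crange c\<close>, subject to the tensor transformation law.  Components of
  vector fields and 1-forms are vectors, those of (1,1)-tensors \<open>\<Phi>\<close> and symmetric (0,2)-tensors
  \<open>g\<close> are matrices, with \<open>\<Phi> X = \<Phi> *v X\<close> and \<open>g(X, Y) = bil g X Y\<close>.\<close>

type_synonym ('a, 'm) vfield = "('a, 'm) chart \<Rightarrow> real^'m \<Rightarrow> real^'m"
type_synonym ('a, 'm) mfield = "('a, 'm) chart \<Rightarrow> real^'m \<Rightarrow> real^'m^'m"

definition bil :: "real^'m^'m \<Rightarrow> real^'m \<Rightarrow> real^'m::finite \<Rightarrow> real" where
  "bil G u v = u \<bullet> (G *v v)"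

definition outer :: "real^'m \<Rightarrow> real^'m^'m::finite" where
  "outer w = (\<chi> i j. w $ i * w $ j)"

definition vector_field :: "('a, 'm::finite) chart set \<Rightarrow> ('a, 'm) vfield \<Rightarrow> bool" where
  "vector_field A X \<longleftrightarrow>
     (\<forall>c\<in>A. smooth_on (crange c) (X c)) \<and>
     (\<forall>c\<in>A. \<forall>d\<in>A. \<forall>x\<in>overlap c d. X d (transition c d x) = jacobian c d x *v X c x)"

definition one_form :: "('a, 'm::finite) chart set \<Rightarrow> ('a, 'm) vfield \<Rightarrow> bool" where
  "one_form A \<eta> \<longleftrightarrow>
     (\<forall>c\<in>A. smooth_on (crange c) (\<eta> c)) \<and>
     (\<forall>c\<in>A. \<forall>d\<in>A. \<forall>x\<in>overlap c d. \<forall>v.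
        \<eta> c x \<bullet> v = \<eta> d (transition c d x) \<bullet> (jacobian c d x *v v))"

definition endo_field :: "('a, 'm::finite) chart set \<Rightarrow> ('a, 'm) mfield \<Rightarrow> bool" where
  "endo_field A \<Phi> \<longleftrightarrow>
     (\<forall>c\<in>A. smooth_on (crange c) (\<Phi> c)) \<and>
     (\<forall>c\<in>A. \<forall>d\<in>A. \<forall>x\<in>overlap c d. \<forall>v.
        jacobian c d x *v (\<Phi> c x *v v) = \<Phi> d (transition c d x) *v (jacobian c d x *v v))"

definition sym_form_field :: "('a, 'm::finite) chart set \<Rightarrow> ('a, 'm) mfield \<Rightarrow> bool" where
  "sym_form_field A g \<longleftrightarrow>
     (\<forall>c\<in>A. smooth_on (crange c) (g c)) \<and>
     (\<forall>c\<in>A. \<forall>x\<in>crange c. \<forall>u v. bil (g c x) u v = bil (g c x) v u) \<and>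
     (\<forall>c\<in>A. \<forall>d\<in>A. \<forall>x\<in>overlap c d. \<forall>u v.
        bil (g c x) u v =
          bil (g d (transition c d x)) (jacobian c d x *v u) (jacobian c d x *v v))"

definition riemannian_metric :: "('a, 'm::finite) chart set \<Rightarrow> ('a, 'm) mfield \<Rightarrow> bool" where
  "riemannian_metric A g \<longleftrightarrow> sym_form_field A g \<and>
     (\<forall>c\<in>A. \<forall>x\<in>crange c. \<forall>v. v \<noteq> 0 \<longrightarrow> bil (g c x) v v > 0)"

text \<open>The index of a symmetric bilinear form is the largest dimension of a subspace on which it is
  negative definite; Lorentzian means nondegenerate of index 1, i.e. signature \<open>(-,+,\<dots>,+)\<close>.\<close>

definition form_index :: "real^'m^'m::finite \<Rightarrow> nat" where
  "form_index G = Max {dim W | W. subspace W \<and> (\<forall>w\<in>W. w \<noteq> 0 \<longrightarrow> bil G w w < 0)}"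

definition lorentzian_metric :: "('a, 'm::finite) chart set \<Rightarrow> ('a, 'm) mfield \<Rightarrow> bool" where
  "lorentzian_metric A g \<longleftrightarrow> sym_form_field A g \<and>
     (\<forall>c\<in>A. \<forall>x\<in>crange c.
        (\<forall>u. (\<forall>v. bil (g c x) u v = 0) \<longrightarrow> u = 0) \<and> form_index (g c x) = 1)"


section \<open>Levi-Civita connection and curvature in coordinates\<close>

text \<open>\<open>christoffel G x k i j\<close> is the symbol with upper index \<open>k\<close>:
  \<open>\<nabla>\<^sub>i \<partial>\<^sub>j = \<Sum>k. christoffel G x k i j \<cdot> \<partial>\<^sub>k\<close>.\<close>

definition christoffel ::
  "(real^'m \<Rightarrow> real^'m^'m) \<Rightarrow> real^'m::finite \<Rightarrow> 'm \<Rightarrow> 'm \<Rightarrow> 'm \<Rightarrow> real" where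
  "christoffel G x k i j = 1/2 * (\<Sum>l\<in>UNIV. matrix_inv (G x) $ k $ l *
     (pd i (\<lambda>y. G y $ j $ l) x + pd j (\<lambda>y. G y $ i $ l) x - pd l (\<lambda>y. G y $ i $ j) x))"

text \<open>The endomorphism \<open>X \<mapsto> \<nabla>\<^sub>X Y\<close>, so that \<open>\<nabla>\<^sub>X Y = nabla_vec G Y x *v X\<close>.\<close>

definition nabla_vec ::
  "(real^'m \<Rightarrow> real^'m^'m) \<Rightarrow> (real^'m \<Rightarrow> real^'m) \<Rightarrow> real^'m::finite \<Rightarrow> real^'m^'m" where
  "nabla_vec G Y x =
     (\<chi> k i. pd i (\<lambda>y. Y y $ k) x + (\<Sum>j\<in>UNIV. christoffel G x k i j * Y x $ j))"

text \<open>The endomorphism \<open>\<nabla>\<^sub>X \<Phi>\<close> at \<open>x\<close>.\<close>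

definition nabla_endo ::
  "(real^'m \<Rightarrow> real^'m^'m) \<Rightarrow> (real^'m \<Rightarrow> real^'m^'m) \<Rightarrow> real^'m::finite \<Rightarrow> real^'m \<Rightarrow> real^'m^'m"
  where
  "nabla_endo G \<Phi> x X = (\<chi> k j. \<Sum>i\<in>UNIV. X $ i *
     (pd i (\<lambda>y. \<Phi> y $ k $ j) x
      + (\<Sum>l\<in>UNIV. christoffel G x k i l * \<Phi> x $ l $ j)
      - (\<Sum>l\<in>UNIV. christoffel G x l i j * \<Phi> x $ k $ l)))"

text \<open>\<open>riemann G x k l i j\<close> is the \<open>\<partial>\<^sub>k\<close>-component of \<open>R(\<partial>\<^sub>i, \<partial>\<^sub>j) \<partial>\<^sub>l\<close>, where
  \<open>R(X, Y) = [\<nabla>\<^sub>X, \<nabla>\<^sub>Y] - \<nabla>\<^bsub>[X, Y]\<^esub>\<close>, and \<open>Ric(Y, Z)\<close> is the trace of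
  \<open>X \<mapsto> R(X, Y) Z\<close> (so round spheres have positive Ricci curvature).\<close>

definition riemann ::
  "(real^'m \<Rightarrow> real^'m^'m) \<Rightarrow> real^'m::finite \<Rightarrow> 'm \<Rightarrow> 'm \<Rightarrow> 'm \<Rightarrow> 'm \<Rightarrow> real" where
  "riemann G x k l i j =
     pd i (\<lambda>y. christoffel G y k j l) x - pd j (\<lambda>y. christoffel G y k i l) x
     + (\<Sum>m\<in>UNIV. christoffel G x k i m * christoffel G x m j l
                   - christoffel G x k j m * christoffel G x m i l)"

definition ricci :: "(real^'m \<Rightarrow> real^'m^'m) \<Rightarrow> real^'m::finite \<Rightarrow> real^'m^'m" where
  "ricci G x = (\<chi> j l. \<Sum>k\<in>UNIV. riemann G x k l k j)"

definition lie_deriv_metric ::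
  "(real^'m \<Rightarrow> real^'m) \<Rightarrow> (real^'m \<Rightarrow> real^'m^'m) \<Rightarrow> real^'m::finite \<Rightarrow> real^'m^'m" where
  "lie_deriv_metric \<xi> G x = (\<chi> i j. \<Sum>k\<in>UNIV.
     \<xi> x $ k * pd k (\<lambda>y. G y $ i $ j) x
     + G x $ k $ j * pd i (\<lambda>y. \<xi> y $ k) x
     + G x $ i $ k * pd j (\<lambda>y. \<xi> y $ k) x)"

definition killing_field ::
  "('a, 'm::finite) chart set \<Rightarrow> ('a, 'm) mfield \<Rightarrow> ('a, 'm) vfield \<Rightarrow> bool" where
  "killing_field A g \<xi> \<longleftrightarrow> vector_field A \<xi> \<and>
     (\<forall>c\<in>A. \<forall>x\<in>crange c. lie_deriv_metric (\<xi> c) (g c) x = 0)"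


section \<open>Sasakian structures\<close>

text \<open>\<open>bil (ext_deriv \<eta> x) X Y = d\<eta>(X, Y)\<close>, normalised by
  \<open>d\<eta>(X, Y) = X \<eta>(Y) - Y \<eta>(X) - \<eta>([X, Y])\<close>.\<close>

definition ext_deriv :: "(real^'m \<Rightarrow> real^'m) \<Rightarrow> real^'m::finite \<Rightarrow> real^'m^'m" where
  "ext_deriv \<eta> x = (\<chi> i j. pd i (\<lambda>y. \<eta> y $ j) x - pd j (\<lambda>y. \<eta> y $ i) x)"

text \<open>The value of \<open>\<eta> \<and> (d\<eta>)\<^sup>n\<close> on \<open>v 0, \<dots>, v (2 * n)\<close>, up to a positive constant factor that
  depends only on \<open>n\<close> and on the convention for the wedge product.\<close>

definition contact_volume ::
  "nat \<Rightarrow> (real^'m \<Rightarrow> real^'m) \<Rightarrow> real^'m::finite \<Rightarrow> (nat \<Rightarrow> real^'m) \<Rightarrow> real" where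
  "contact_volume n \<eta> x v =
     (\<Sum>\<sigma> | \<sigma> permutes {..2 * n}. of_int (sign \<sigma>) * (\<eta> x \<bullet> v (\<sigma> 0)) *
        (\<Prod>i<n. bil (ext_deriv \<eta> x) (v (\<sigma> (2 * i + 1))) (v (\<sigma> (2 * i + 2)))))"

definition contact_form :: "nat \<Rightarrow> ('a, 'm::finite) chart set \<Rightarrow> ('a, 'm) vfield \<Rightarrow> bool" where
  "contact_form n A \<eta> \<longleftrightarrow> one_form A \<eta> \<and>
     (\<forall>c\<in>A. \<forall>x\<in>crange c. \<exists>v. contact_volume n (\<eta> c) x v \<noteq> 0)"

text \<open>That the metric cone is Kaehler is expressed by the equivalent identity
  \<open>(\<nabla>\<^sub>X \<Phi>) Y = g(X, Y) \<xi> - \<eta>(Y) X\<close>.\<close>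

definition sasakian ::
  "nat \<Rightarrow> 'a topology \<Rightarrow> ('a, 'm::finite) chart set \<Rightarrow>
   ('a, 'm) vfield \<Rightarrow> ('a, 'm) vfield \<Rightarrow> ('a, 'm) mfield \<Rightarrow> ('a, 'm) mfield \<Rightarrow> bool" where
  "sasakian n M A \<xi> \<eta> \<Phi> g \<longleftrightarrow>
     smooth_manifold M A \<and> CARD('m) = 2 * n + 1 \<and>
     vector_field A \<xi> \<and> contact_form n A \<eta> \<and> endo_field A \<Phi> \<and> riemannian_metric A g \<and>
     (\<forall>c\<in>A. \<forall>x\<in>crange c.
        \<eta> c x \<bullet> \<xi> c x = 1 \<and>
        (\<forall>X. \<Phi> c x *v (\<Phi> c x *v X) = - X + (\<eta> c x \<bullet> X) *\<^sub>R \<xi> c x) \<and>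
        (\<forall>X Y. bil (g c x) (\<Phi> c x *v X) (\<Phi> c x *v Y)
                 = bil (g c x) X Y - (\<eta> c x \<bullet> X) * (\<eta> c x \<bullet> Y)) \<and>
        (\<forall>X Y. nabla_endo (g c) (\<Phi> c) x X *v Y
                 = bil (g c x) X Y *\<^sub>R \<xi> c x - (\<eta> c x \<bullet> Y) *\<^sub>R X))"

definition eta_einstein ::
  "('a, 'm::finite) chart set \<Rightarrow> ('a, 'm) vfield \<Rightarrow> ('a, 'm) mfield \<Rightarrow> real \<Rightarrow> real \<Rightarrow> bool" where
  "eta_einstein A \<eta> g lam nu \<longleftrightarrow>
     (\<forall>c\<in>A. \<forall>x\<in>crange c. ricci (g c) x = lam *\<^sub>R g c x + nu *\<^sub>R outer (\<eta> c x))"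

definition lorentzian_sasakian ::
  "nat \<Rightarrow> 'a topology \<Rightarrow> ('a, 'm::finite) chart set \<Rightarrow> ('a, 'm) vfield \<Rightarrow> ('a, 'm) mfield \<Rightarrow> bool"
  where
  "lorentzian_sasakian n M A \<xi> g \<longleftrightarrow>
     smooth_manifold M A \<and> CARD('m) = 2 * n + 1 \<and>
     lorentzian_metric A g \<and> killing_field A g \<xi> \<and>
     (\<forall>c\<in>A. \<forall>x\<in>crange c.
        bil (g c x) (\<xi> c x) (\<xi> c x) = -1 \<and>
        (\<forall>X Y. nabla_endo (g c) (nabla_vec (g c) (\<xi> c)) x X *v Y
                 = bil (g c x) X Y *\<^sub>R \<xi> c x - bil (g c x) Y (\<xi> c x) *\<^sub>R X))"

definition einstein_metric :: "('a, 'm::finite) chart set \<Rightarrow> ('a, 'm) mfield \<Rightarrow> bool" where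
  "einstein_metric A g \<longleftrightarrow> (\<exists>\<kappa>::real. \<forall>c\<in>A. \<forall>x\<in>crange c. ricci (g c) x = \<kappa> *\<^sub>R g c x)"

definition lorentzian_sasakian_einstein ::
  "nat \<Rightarrow> 'a topology \<Rightarrow> ('a, 'm::finite) chart set \<Rightarrow> ('a, 'm) vfield \<Rightarrow> ('a, 'm) mfield \<Rightarrow> bool"
  where
  "lorentzian_sasakian_einstein n M A \<xi> g \<longleftrightarrow> lorentzian_sasakian n M A \<xi> g \<and> einstein_metric A g"


section \<open>Quasi-regularity\<close>

definition integral_curve ::
  "'a topology \<Rightarrow> ('a, 'm::finite) chart set \<Rightarrow> ('a, 'm) vfield \<Rightarrow> real set \<Rightarrow> (real \<Rightarrow> 'a) \<Rightarrow> bool"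
  where
  "integral_curve M A \<xi> I \<gamma> \<longleftrightarrow>
     open I \<and> is_interval I \<and> continuous_map (top_of_set I) M \<gamma> \<and>
     (\<forall>t\<in>I. \<forall>c\<in>A. \<gamma> t \<in> cdom c \<longrightarrow>
        ((\<lambda>s. cmap c (\<gamma> s)) has_vector_derivative \<xi> c (cmap c (\<gamma> t))) (at t))"

definition leaf ::
  "'a topology \<Rightarrow> ('a, 'm::finite) chart set \<Rightarrow> ('a, 'm) vfield \<Rightarrow> 'a \<Rightarrow> 'a set" where
  "leaf M A \<xi> p = {q. \<exists>I \<gamma> s t. integral_curve M A \<xi> I \<gamma> \<and> s \<in> I \<and> t \<in> I \<and> \<gamma> s = p \<and> \<gamma> t = q}"

text \<open>A foliated chart maps onto an open coordinate box, with the tangent line \<open>\<real>\<xi>\<close> of the foliation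
  spanned by the \<open>i\<close>-th coordinate direction.  Its plaques are the level sets of the remaining
  (transverse) coordinates; a leaf meets the domain in a union of plaques, and each plaque contained
  in the leaf counts as one passage of the leaf through the domain.\<close>

definition foliated_chart ::
  "('a, 'm::finite) chart set \<Rightarrow> ('a, 'm) vfield \<Rightarrow> 'm \<Rightarrow> ('a, 'm) chart \<Rightarrow> bool" where
  "foliated_chart A \<xi> i c \<longleftrightarrow> c \<in> A \<and> (\<exists>l u. crange c = box l u) \<and>
     (\<forall>x\<in>crange c. span {\<xi> c x} = span {axis i 1})"

definition plaques :: "'m \<Rightarrow> ('a, 'm::finite) chart \<Rightarrow> 'a set set" where
  "plaques i c = {{q \<in> cdom c. \<forall>j. j \<noteq> i \<longrightarrow> cmap c q $ j = cmap c p $ j} | p. p \<in> cdom c}"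

definition quasi_regular ::
  "'a topology \<Rightarrow> ('a, 'm::finite) chart set \<Rightarrow> ('a, 'm) vfield \<Rightarrow> bool" where
  "quasi_regular M A \<xi> \<longleftrightarrow>
     (\<exists>k>0. \<forall>p\<in>topspace M. \<exists>i c. foliated_chart A \<xi> i c \<and> p \<in> cdom c \<and>
        (\<forall>q\<in>topspace M. finite {P \<in> plaques i c. P \<subseteq> leaf M A \<xi> q} \<and>
                         card {P \<in> plaques i c. P \<subseteq> leaf M A \<xi> q} \<le> k))"

end

theory Submission
  imports Defs
begin

text \<open>Put \<open>g' = - (a g + a (a - 1) \<eta> \<otimes> \<eta>)\<close>.  The Sasakian identities give \<open>\<nabla>\<^sub>X \<xi> = - \<Phi> X\<close> and
  \<open>(\<nabla>\<^sub>X \<eta>) Y = g(X, \<Phi> Y)\<close>, and Koszul's formula then gives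
  \<open>\<nabla>'\<^sub>X Y = \<nabla>\<^sub>X Y + (1 - a) (\<eta>(X) \<Phi> Y + \<eta>(Y) \<Phi> X)\<close>.  Hence \<open>\<nabla>' \<xi>' = - \<Phi>\<close>, which yields the
  Lorentzian Sasakian identity, and tracing the curvature of \<open>\<nabla>'\<close> yields
  \<open>Ric' = Ric + 2 (1 - a) g + (2 n (1 - a)\<^sup>2 - (4 n + 2) (1 - a)) \<eta> \<otimes> \<eta>\<close>.  Contracting
  \<open>R(X, Y) \<xi> = \<eta>(Y) X - \<eta>(X) Y\<close> shows \<open>Ric(\<xi>, \<xi>) = 2 n\<close>, i.e. \<open>lam + nu = 2 n\<close>, and the stated
  value of \<open>a\<close> is the one for which \<open>Ric' = - 2 n g'\<close>.  Everything is local, so it is done in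
  charts.\<close>

section \<open>Calculus of directional derivatives\<close>

abbreviation dd :: "('v::real_normed_vector \<Rightarrow> 'w::real_normed_vector) \<Rightarrow> 'v \<Rightarrow> 'v \<Rightarrow> 'w" where
  "dd f x \<equiv> frechet_derivative f (at x)"

lemma dd_eqI: "(f has_derivative f') (at x) \<Longrightarrow> dd f x = f'"
  using frechet_derivative_at by metis

lemma has_derivative_dd: "f differentiable (at x) \<Longrightarrow> (f has_derivative dd f x) (at x)"
  by (simp add: frechet_derivative_works)

text \<open>\<open>frechet_derivative\<close> is a Hilbert choice among the derivatives at
  \<open>x\<close>, and being a derivative at \<open>x\<close> depends only on the germ there; so
  the two choices coincide, whether or not a derivative exists.\<close>

lemma dd_cong:
  assumes "open S" "x \<in> S" "\<And>y. y \<in> S \<Longrightarrow> f y = g y"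
  shows "dd f x = dd g x"
proof -
  have "(f has_derivative f') (at x) \<longleftrightarrow> (g has_derivative f') (at x)" for f'
    using has_derivative_transform_within_open[OF _ assms(1,2)] assms(3) by metis
  then show ?thesis by (simp add: frechet_derivative_def)
qed

lemma differentiable_cong_open:
  assumes "open S" "x \<in> S" "\<And>y. y \<in> S \<Longrightarrow> f y = g y" "f differentiable (at x)"
  shows "g differentiable (at x)"
  using has_derivative_transform_within_open[OF _ assms(1,2)] assms(3,4)
  unfolding differentiable_def by metis

lemma dd_add:
  "f differentiable (at x) \<Longrightarrow> g differentiable (at x) \<Longrightarrow>
    dd (\<lambda>y. f y + g y) x u = dd f x u + dd g x u"
  by (subst dd_eqI[OF has_derivative_add[OF has_derivative_dd has_derivative_dd]]) auto

lemma dd_minus: "f differentiable (at x) \<Longrightarrow> dd (\<lambda>y. - f y) x u = - dd f x u"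
  by (subst dd_eqI[OF has_derivative_minus[OF has_derivative_dd]]) auto

lemma (in bounded_linear) dd:
  "g differentiable (at x) \<Longrightarrow> dd (\<lambda>y. f (g y)) x u = f (dd g x u)"
  by (subst dd_eqI[OF has_derivative[OF has_derivative_dd]]) auto

lemma (in bounded_linear) differentiable:
  "g differentiable F \<Longrightarrow> (\<lambda>y. f (g y)) differentiable F"
  unfolding differentiable_def using has_derivative by blast

lemma (in bounded_bilinear) dd:
  "f differentiable (at x) \<Longrightarrow> g differentiable (at x) \<Longrightarrow>
    dd (\<lambda>y. prod (f y) (g y)) x u = prod (f x) (dd g x u) + prod (dd f x u) (g x)"
  by (subst dd_eqI[OF FDERIV[OF has_derivative_dd has_derivative_dd]]) auto

lemma (in bounded_bilinear) differentiable:
  "f differentiable (at x) \<Longrightarrow> g differentiable (at x) \<Longrightarrow> (\<lambda>y. prod (f y) (g y)) differentiable (at x)"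
  unfolding differentiable_def using FDERIV by blast

lemmas dd_linear = linear_frechet_derivative

section \<open>Closure properties of \<open>Ck_on\<close> and \<open>smooth_on\<close>\<close>

lemma Ck_on_cong:
  assumes "open S" "\<And>y. y \<in> S \<Longrightarrow> f y = g y"
  shows "Ck_on k S f \<longleftrightarrow> Ck_on k S g"
  using assms(2)
proof (induction k arbitrary: f g)
  case 0
  then show ?case by (auto cong: continuous_on_cong)
next
  case (Suc k)
  have "f differentiable (at x) \<longleftrightarrow> g differentiable (at x)" if "x \<in> S" for x
    using differentiable_cong_open[OF assms(1) that] Suc.prems by metis
  moreover have "Ck_on k S (\<lambda>x. dd f x v) = Ck_on k S (\<lambda>x. dd g x v)" for v
    by (rule Suc.IH) (metis Suc.prems assms(1) dd_cong)
  ultimately show ?case by auto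
qed

lemma Ck_on_SucD: "Ck_on (Suc k) S f \<Longrightarrow> Ck_on k S f"
proof (induction k arbitrary: f)
  case 0
  then show ?case
    by (auto intro!: continuous_at_imp_continuous_on differentiable_imp_continuous_within)
next
  case (Suc k)
  from Suc.prems have 1: "\<forall>x\<in>S. f differentiable (at x)" "\<And>v. Ck_on (Suc k) S (\<lambda>x. dd f x v)"
    unfolding Ck_on.simps(2)[of "Suc k"] by auto
  show ?case unfolding Ck_on.simps(2)[of k] using 1(1) Suc.IH[OF 1(2)] by blast
qed

lemma Ck_on_add:
  assumes "open S" "Ck_on k S f" "Ck_on k S g"
  shows "Ck_on k S (\<lambda>x. f x + g x)"
  using assms(2,3)
proof (induction k arbitrary: f g)
  case (Suc k)
  have "Ck_on k S (\<lambda>x. dd f x v + dd g x v)" for v using Suc by simp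
  moreover have "dd (\<lambda>x. f x + g x) x v = dd f x v + dd g x v" if "x \<in> S" for x v
    using Suc.prems that by (simp add: dd_add)
  ultimately have "Ck_on k S (\<lambda>x. dd (\<lambda>x. f x + g x) x v)" for v
    by (subst Ck_on_cong[OF assms(1)]) auto
  then show ?case using Suc.prems by simp
qed (auto intro: continuous_on_add)

lemma (in bounded_linear) Ck_on:
  assumes "open S" "Ck_on k S g"
  shows "Ck_on k S (\<lambda>x. f (g x))"
  using assms(2)
proof (induction k arbitrary: g)
  case (Suc k)
  have "Ck_on k S (\<lambda>x. f (dd g x v))" for v using Suc by simp
  moreover have "dd (\<lambda>x. f (g x)) x v = f (dd g x v)" if "x \<in> S" for x v
    using Suc.prems that by (simp add: dd)
  ultimately have "Ck_on k S (\<lambda>x. dd (\<lambda>x. f (g x)) x v)" for v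
    by (subst Ck_on_cong[OF assms(1)]) auto
  then show ?case using Suc.prems by (auto intro: differentiable)
qed (auto intro: continuous_on)

text \<open>By the Leibniz rule the derivative is a sum of products with one undifferentiated
  factor; \<open>Ck_on_SucD\<close> lowers the order of that factor so that the induction hypothesis
  applies.\<close>

lemma (in bounded_bilinear) Ck_on:
  assumes "open S" "Ck_on k S f" "Ck_on k S g"
  shows "Ck_on k S (\<lambda>x. prod (f x) (g x))"
  using assms(2,3)
proof (induction k arbitrary: f g)
  case (Suc k)
  have "Ck_on k S (\<lambda>x. prod (f x) (dd g x v) + prod (dd f x v) (g x))" for v
    using Suc.prems Ck_on_SucD[OF Suc.prems(1)] Ck_on_SucD[OF Suc.prems(2)]
    by (intro Ck_on_add assms(1) Suc.IH) auto
  moreover have "dd (\<lambda>x. prod (f x) (g x)) x v = prod (f x) (dd g x v) + prod (dd f x v) (g x)"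
    if "x \<in> S" for x v
    using Suc.prems that by (simp add: dd)
  ultimately have "Ck_on k S (\<lambda>x. dd (\<lambda>x. prod (f x) (g x)) x v)" for v
    by (subst Ck_on_cong[OF assms(1)]) auto
  then show ?case using Suc.prems by (auto intro: differentiable)
qed (auto intro: continuous_on)

lemma smooth_on_differentiable: "smooth_on S f \<Longrightarrow> x \<in> S \<Longrightarrow> f differentiable (at x)"
  unfolding smooth_on_def by (metis Ck_on.simps(2))

lemma smooth_on_dd: "smooth_on S f \<Longrightarrow> smooth_on S (\<lambda>x. dd f x v)"
  unfolding smooth_on_def by (metis Ck_on.simps(2))

lemma smooth_on_continuous: "smooth_on S f \<Longrightarrow> continuous_on S f"
  unfolding smooth_on_def by (metis Ck_on.simps(1))

lemma smooth_on_add: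
  "open S \<Longrightarrow> smooth_on S f \<Longrightarrow> smooth_on S g \<Longrightarrow> smooth_on S (\<lambda>x. f x + g x)"
  unfolding smooth_on_def by (simp add: Ck_on_add)

lemma (in bounded_linear) smooth_on: "open S \<Longrightarrow> smooth_on S g \<Longrightarrow> smooth_on S (\<lambda>x. f (g x))"
  unfolding smooth_on_def by (simp add: Ck_on)

lemma (in bounded_bilinear) smooth_on:
  "open S \<Longrightarrow> smooth_on S f \<Longrightarrow> smooth_on S g \<Longrightarrow> smooth_on S (\<lambda>x. prod (f x) (g x))"
  unfolding smooth_on_def by (simp add: Ck_on)

section \<open>Symmetry of second derivatives\<close>

lemma open_slice:
  fixes x u v :: "'v::real_normed_vector"
  assumes "open S" "x \<in> S"
  obtains d where "d > 0" "\<And>s t. \<bar>s\<bar> < d \<Longrightarrow> \<bar>t\<bar> < d \<Longrightarrow> x + s *\<^sub>R u + t *\<^sub>R v \<in> S"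
proof -
  obtain e where e: "e > 0" "ball x e \<subseteq> S" using assms open_contains_ball by blast
  \<comment> \<open>The summand 1 keeps the denominator positive when \<open>u\<close> and
    \<open>v\<close> both vanish, and it makes the final bound strict.\<close>
  define d where "d = e / (norm u + norm v + 1)"
  have p: "norm u + norm v + 1 > 0" by (smt (verit) norm_ge_zero)
  show thesis
  proof (rule that)
    show "d > 0" unfolding d_def using e(1) p by simp
    fix s t :: real assume st: "\<bar>s\<bar> < d" "\<bar>t\<bar> < d"
    have "norm (s *\<^sub>R u + t *\<^sub>R v) \<le> \<bar>s\<bar> * norm u + \<bar>t\<bar> * norm v"
      by (metis norm_scaleR norm_triangle_ineq)
    also have "\<dots> \<le> d * norm u + d * norm v"
      using st by (intro add_mono mult_right_mono) auto
    also have "\<dots> < d * (norm u + norm v + 1)" using \<open>d > 0\<close> by (simp add: algebra_simps)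
    also have "\<dots> = e" unfolding d_def using p by simp
    finally have "x + s *\<^sub>R u + t *\<^sub>R v \<in> ball x e"
      by (simp add: dist_norm norm_minus_commute add.assoc) (metis add.commute)
    then show "x + s *\<^sub>R u + t *\<^sub>R v \<in> S" using e(2) by blast
  qed
qed

lemma dd_along_line:
  fixes f :: "'v::real_normed_vector \<Rightarrow> real"
  assumes "f differentiable (at (p + s *\<^sub>R u))"
  shows "((\<lambda>s. f (p + s *\<^sub>R u)) has_real_derivative dd f (p + s *\<^sub>R u) u) (at s)"
proof -
  have "((\<lambda>s. p + s *\<^sub>R u) has_derivative (\<lambda>h. h *\<^sub>R u)) (at s)"
    by (auto intro!: derivative_eq_intros)
  from has_derivative_compose[OF this has_derivative_dd[OF assms]]
  have "((\<lambda>s. f (p + s *\<^sub>R u)) has_derivative (\<lambda>h. dd f (p + s *\<^sub>R u) (h *\<^sub>R u))) (at s)" .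
  moreover have "dd f (p + s *\<^sub>R u) (h *\<^sub>R u) = dd f (p + s *\<^sub>R u) u * h" for h
    using linear_cmul[OF dd_linear[OF assms]] by simp
  ultimately show ?thesis by (simp add: has_field_derivative_def)
qed

text \<open>Both mixed second derivatives are limits of the same second difference, which gives their
  equality.\<close>

lemma second_difference_mvt:
  fixes f :: "'v::real_normed_vector \<Rightarrow> real"
  assumes f: "\<And>y. y \<in> S \<Longrightarrow> f differentiable (at y)"
    and fu: "\<And>y. y \<in> S \<Longrightarrow> (\<lambda>y. dd f y u) differentiable (at y)"
    and S: "\<And>s t. 0 \<le> s \<Longrightarrow> s \<le> h \<Longrightarrow> 0 \<le> t \<Longrightarrow> t \<le> h \<Longrightarrow> x + s *\<^sub>R u + t *\<^sub>R v \<in> S"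
    and "h > 0"
  obtains s t where "0 < s" "s < h" "0 < t" "t < h"
    "f (x + h *\<^sub>R u + h *\<^sub>R v) - f (x + h *\<^sub>R u) - f (x + h *\<^sub>R v) + f x =
       h^2 * dd (\<lambda>y. dd f y u) (x + s *\<^sub>R u + t *\<^sub>R v) v"
proof -
  \<comment> \<open>The second difference is \<open>\<phi> h - \<phi> 0\<close>; the mean value
    theorem in direction \<open>u\<close>, then in direction \<open>v\<close>, supplies the two
    factors \<open>h\<close>.\<close>
  define \<phi> where "\<phi> s = f ((x + h *\<^sub>R v) + s *\<^sub>R u) - f (x + s *\<^sub>R u)" for s
  have "(\<phi> has_real_derivative dd f ((x + h *\<^sub>R v) + s *\<^sub>R u) u - dd f (x + s *\<^sub>R u) u) (at s)"
    if "0 \<le> s" "s \<le> h" for s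
    unfolding \<phi>_def
    using S[of s h] S[of s 0] that \<open>h > 0\<close>
    by (intro DERIV_diff dd_along_line f) (auto simp: algebra_simps)
  from MVT2[OF \<open>h > 0\<close> this] obtain s where s: "0 < s" "s < h"
    "\<phi> h - \<phi> 0 = h * (dd f ((x + h *\<^sub>R v) + s *\<^sub>R u) u - dd f (x + s *\<^sub>R u) u)" by auto
  have "((\<lambda>t. dd f ((x + s *\<^sub>R u) + t *\<^sub>R v) u) has_real_derivative
      dd (\<lambda>y. dd f y u) ((x + s *\<^sub>R u) + t *\<^sub>R v) v) (at t)" if "0 \<le> t" "t \<le> h" for t
    using S[of s t] that s by (intro dd_along_line fu) auto
  from MVT2[OF \<open>h > 0\<close> this] obtain t where t: "0 < t" "t < h"
    "dd f ((x + s *\<^sub>R u) + h *\<^sub>R v) u - dd f ((x + s *\<^sub>R u) + 0 *\<^sub>R v) u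
       = h * dd (\<lambda>y. dd f y u) ((x + s *\<^sub>R u) + t *\<^sub>R v) v" by auto
  show thesis
  proof (rule that[OF s(1,2) t(1,2)])
    have "\<phi> h - \<phi> 0 = h * (h * dd (\<lambda>y. dd f y u) ((x + s *\<^sub>R u) + t *\<^sub>R v) v)"
      using s(3) t(3) by (simp add: algebra_simps)
    then show "f (x + h *\<^sub>R u + h *\<^sub>R v) - f (x + h *\<^sub>R u) - f (x + h *\<^sub>R v) + f x =
       h^2 * dd (\<lambda>y. dd f y u) (x + s *\<^sub>R u + t *\<^sub>R v) v"
      by (simp add: \<phi>_def power2_eq_square algebra_simps)
  qed
qed

text \<open>If the values differed, continuity would keep the two mixed derivatives in disjoint
  balls on a neighbourhood \<open>V\<close> of \<open>x\<close>. But the second difference is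
  symmetric in \<open>u\<close> and \<open>v\<close>, so its two mean value forms give both
  derivatives a common value inside \<open>V\<close>.\<close>

lemma dd_commute_real:
  fixes f :: "'v::real_normed_vector \<Rightarrow> real"
  assumes S: "open S" "x \<in> S" and f: "smooth_on S f"
  shows "dd (\<lambda>y. dd f y u) x v = dd (\<lambda>y. dd f y v) x u"
proof (rule ccontr)
  define F where "F y = dd (\<lambda>y. dd f y u) y v" for y
  define H where "H y = dd (\<lambda>y. dd f y v) y u" for y
  assume "\<not> ?thesis"
  then have ne: "dist (F x) (H x) > 0" by (simp add: F_def H_def)
  have "continuous_on S F" "continuous_on S H"
    unfolding F_def H_def by (intro smooth_on_continuous smooth_on_dd f)+
  then have FH: "open (F -` B \<inter> S)" "open (H -` B \<inter> S)" if "open B" for B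
    using continuous_on_open_vimage[OF S(1)] that by blast+
  define r where "r = dist (F x) (H x) / 2"
  define V where "V = (F -` ball (F x) r \<inter> S) \<inter> (H -` ball (H x) r \<inter> S)"
  have V: "open V" "x \<in> V"
    using FH[of "ball _ r"] S ne by (auto simp: V_def r_def)
  obtain d where d: "d > 0" "\<And>s t. \<bar>s\<bar> < d \<Longrightarrow> \<bar>t\<bar> < d \<Longrightarrow> x + s *\<^sub>R u + t *\<^sub>R v \<in> V"
    using open_slice[OF V(1,2)] by blast
  define h where "h = d / 2"
  have h: "0 < h" "h < d" using d(1) by (auto simp: h_def)
  have VS: "V \<subseteq> S" by (auto simp: V_def)
  have diff: "y \<in> V \<Longrightarrow> f differentiable (at y)"
    "y \<in> V \<Longrightarrow> (\<lambda>y. dd f y w) differentiable (at y)" for y w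
    using VS smooth_on_differentiable[OF f] smooth_on_differentiable[OF smooth_on_dd[OF f]] by blast+
  have V1: "x + s *\<^sub>R u + t *\<^sub>R v \<in> V" "x + s *\<^sub>R v + t *\<^sub>R u \<in> V"
    if "0 \<le> s" "s \<le> h" "0 \<le> t" "t \<le> h" for s t
    using d(2)[of s t] d(2)[of t s] that h by (auto simp: add.commute add.left_commute)
  obtain s t where st: "0 < s" "s < h" "0 < t" "t < h"
    "f (x + h *\<^sub>R u + h *\<^sub>R v) - f (x + h *\<^sub>R u) - f (x + h *\<^sub>R v) + f x =
       h^2 * F (x + s *\<^sub>R u + t *\<^sub>R v)"
    unfolding F_def by (rule second_difference_mvt[of V, OF diff V1(1) h(1)])
  obtain s' t' where st': "0 < s'" "s' < h" "0 < t'" "t' < h"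
    "f (x + h *\<^sub>R v + h *\<^sub>R u) - f (x + h *\<^sub>R v) - f (x + h *\<^sub>R u) + f x =
       h^2 * H (x + s' *\<^sub>R v + t' *\<^sub>R u)"
    unfolding H_def by (rule second_difference_mvt[of V, OF diff V1(2) h(1)])
  have "h^2 * F (x + s *\<^sub>R u + t *\<^sub>R v) = h^2 * H (x + s' *\<^sub>R v + t' *\<^sub>R u)"
    using st(5) st'(5) by (simp add: algebra_simps)
  then have "F (x + s *\<^sub>R u + t *\<^sub>R v) = H (x + s' *\<^sub>R v + t' *\<^sub>R u)"
    using h(1) by simp
  moreover have "x + s *\<^sub>R u + t *\<^sub>R v \<in> V" "x + s' *\<^sub>R v + t' *\<^sub>R u \<in> V"
    using V1 st st' by force+
  ultimately show False unfolding V_def r_def by (auto simp: dist_real_def) (smt (verit) field_sum_of_halves)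
qed

text \<open>Pairing with a fixed vector \<open>b\<close> commutes with differentiation, and vectors
  with equal pairings are equal; this reduces the claim to real-valued maps.\<close>

lemma dd_commute:
  fixes f :: "'v::real_normed_vector \<Rightarrow> 'w::real_inner"
  assumes S: "open S" "x \<in> S" and f: "smooth_on S f"
  shows "dd (\<lambda>y. dd f y u) x v = dd (\<lambda>y. dd f y v) x u"
proof -
  have *: "dd (\<lambda>y. dd f y u) x v \<bullet> b = dd (\<lambda>y. dd (\<lambda>y. f y \<bullet> b) y u) x v" for b u v
  proof -
    interpret bl: bounded_linear "\<lambda>w. w \<bullet> b" by (rule bounded_linear_inner_left)
    have "dd (\<lambda>y. f y \<bullet> b) y u = dd f y u \<bullet> b" if "y \<in> S" for y u
      using smooth_on_differentiable[OF f that] by (rule bl.dd)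
    then have "dd (\<lambda>y. dd (\<lambda>y. f y \<bullet> b) y u) x v = dd (\<lambda>y. dd f y u \<bullet> b) x v"
      by (metis (no_types, lifting) dd_cong[OF S])
    also have "\<dots> = dd (\<lambda>y. dd f y u) x v \<bullet> b"
      using smooth_on_differentiable[OF smooth_on_dd[OF f] S(2)] by (rule bl.dd)
    finally show ?thesis by simp
  qed
  have "smooth_on S (\<lambda>y. f y \<bullet> b)" for b
    by (rule bounded_linear.smooth_on[OF bounded_linear_inner_left S(1) f])
  from dd_commute_real[OF S this] show ?thesis
    unfolding vector_eq_rdot[symmetric, of "dd (\<lambda>y. dd f y u) x v"] * by (simp add: *)
qed

section \<open>The Levi-Civita connection in a chart\<close>

lemma sum_axis [simp]:
  fixes f :: "'m::finite \<Rightarrow> real"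
  shows "(\<Sum>i\<in>UNIV. f i * axis j 1 $ i) = f j" "(\<Sum>i\<in>UNIV. axis j 1 $ i * f i) = f j"
  by (simp_all add: axis_def if_distrib if_distribR cong: if_cong)

lemma linear_axis_expand:
  fixes f :: "real^'m::finite \<Rightarrow> 'w::real_vector"
  assumes "linear f"
  shows "f u = (\<Sum>i\<in>UNIV. u $ i *\<^sub>R f (axis i 1))"
proof -
  have "u = (\<Sum>i\<in>UNIV. u $ i *\<^sub>R axis i 1)"
    by (metis (mono_tags, lifting) basis_expansion scalar_mult_eq_scaleR sum.cong)
  then show ?thesis
    by (metis (mono_tags, lifting) assms linear_scale linear_sum sum.cong)
qed

lemma linear_eq_axis:
  fixes f g :: "real^'m::finite \<Rightarrow> 'w::real_vector"
  assumes "linear f" "linear g" "\<And>i. f (axis i 1) = g (axis i 1)"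
  shows "f = g"
proof
  fix u show "f u = g u"
    using linear_axis_expand[OF assms(1), of u] linear_axis_expand[OF assms(2), of u] assms(3) by simp
qed

text \<open>The tool for passing from definitions by indices to index-free identities.\<close>

lemma bilinear_eq_axis:
  fixes f g :: "real^'m::finite \<Rightarrow> real^'n::finite \<Rightarrow> 'w::real_vector"
  assumes "bilinear f" "bilinear g" "\<And>i j. f (axis i 1) (axis j 1) = g (axis i 1) (axis j 1)"
  shows "f = g"
proof -
  have "f (axis i 1) = g (axis i 1)" for i
    using assms by (intro linear_eq_axis) (auto simp: bilinear_def)
  then have "(\<lambda>u. f u v) = (\<lambda>u. g u v)" for v
    using assms by (intro linear_eq_axis) (auto simp: bilinear_def)
  then show ?thesis by (auto simp: fun_eq_iff)
qed

lemma bounded_bilinear_mult_vec: "bounded_bilinear ((*v) :: real^'m^'n \<Rightarrow> real^'m::finite \<Rightarrow> real^'n::finite)"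
  unfolding bilinear_conv_bounded_bilinear[symmetric] bilinear_def
  by (auto intro!: linearI simp: matrix_vector_right_distrib matrix_vector_mult_add_rdistrib
      matrix_vector_mult_scaleR scaleR_matrix_vector_assoc[symmetric])

lemma bil_simps:
  "bil G (u + v) w = bil G u w + bil G v w" "bil G w (u + v) = bil G w u + bil G w v"
  "bil G (u - v) w = bil G u w - bil G v w" "bil G w (u - v) = bil G w u - bil G w v"
  "bil G (c *\<^sub>R u) w = c * bil G u w" "bil G w (c *\<^sub>R u) = c * bil G w u"
  "bil G (- u) w = - bil G u w" "bil G w (- u) = - bil G w u"
  "bil G 0 w = 0" "bil G w 0 = 0"
  by (simp_all add: bil_def inner_simps matrix_vector_right_distrib matrix_vector_mult_diff_distrib
      matrix_vector_mult_scaleR linear_neg)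

lemma bil_matrix_simps:
  "bil (G + H) u v = bil G u v + bil H u v" "bil (c *\<^sub>R G) u v = c * bil G u v"
  "bil (- G) u v = - bil G u v"
  by (simp_all add: bil_def matrix_vector_mult_add_rdistrib scaleR_matrix_vector_assoc[symmetric]
     inner_simps) (metis inner_minus_right scaleR_matrix_vector_assoc scaleR_minus1_left)

lemma bil_axis: "bil G (axis i 1) (axis j 1) = G $ i $ j"
  by (simp add: bil_def inner_axis' matrix_vector_mult_basis column_def)

lemma bounded_linear_bil: "bounded_linear (\<lambda>G. bil G u v)"
  unfolding linear_conv_bounded_linear[symmetric]
  by (rule linearI) (simp_all add: bil_matrix_simps)

lemma pd_nth: "f differentiable (at x) \<Longrightarrow> pd i (\<lambda>y. f y $ k) x = dd f x (axis i 1) $ k"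
  unfolding pd_def by (rule bounded_linear.dd[OF bounded_linear_vec_nth])

lemma pd_nth_nth:
  "f differentiable (at x) \<Longrightarrow> pd i (\<lambda>y. f y $ k $ l) x = dd f x (axis i 1) $ k $ l"
  by (subst pd_nth) (auto simp: bounded_linear.dd[OF bounded_linear_vec_nth]
      intro: bounded_linear.differentiable[OF bounded_linear_vec_nth])

lemma matrix_inv_right: "invertible (A :: real^'m^'m::finite) \<Longrightarrow> A ** matrix_inv A = mat 1"
  unfolding invertible_def matrix_inv_def by (rule someI2_ex) auto

section \<open>Index-free forms of the connection and its curvature\<close>

text \<open>The Christoffel symbols as a vector-valued bilinear map; \<open>\<nabla>\<^sub>u V = dd V x u + gam G x u (V x)\<close>.\<close>

definition gam :: "(real^'m \<Rightarrow> real^'m^'m) \<Rightarrow> real^'m::finite \<Rightarrow> real^'m \<Rightarrow> real^'m \<Rightarrow> real^'m" where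
  "gam G x u v = (\<chi> k. \<Sum>i\<in>UNIV. \<Sum>j\<in>UNIV. christoffel G x k i j * u $ i * v $ j)"

lemma gam_axis: "gam G x (axis i 1) (axis j 1) $ k = christoffel G x k i j"
  by (simp add: gam_def)

lemma gam_axis_left: "gam G x (axis i 1) w $ k = (\<Sum>m\<in>UNIV. christoffel G x k i m * w $ m)"
  unfolding gam_def vec_lambda_beta
  by (subst sum.swap) (simp add: axis_def if_distrib if_distribR cong: if_cong)

lemma bilinear_gam: "bilinear (gam G x)"
  unfolding bilinear_def gam_def
  by (auto intro!: linearI simp: vec_eq_iff algebra_simps sum.distrib sum_distrib_left)

lemma gam_simps:
  "gam G x (u + v) w = gam G x u w + gam G x v w" "gam G x w (u + v) = gam G x w u + gam G x w v"
  "gam G x (u - v) w = gam G x u w - gam G x v w" "gam G x w (u - v) = gam G x w u - gam G x w v"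
  "gam G x (c *\<^sub>R u) w = c *\<^sub>R gam G x u w" "gam G x w (c *\<^sub>R u) = c *\<^sub>R gam G x w u"
  "gam G x (- u) w = - gam G x u w" "gam G x w (- u) = - gam G x w u"
  "gam G x 0 w = 0" "gam G x w 0 = 0"
  by (simp_all add: bilinear_ladd bilinear_radd bilinear_lsub bilinear_rsub bilinear_lmul
     bilinear_rmul bilinear_lneg bilinear_rneg bilinear_lzero bilinear_rzero bilinear_gam)

text \<open>The right side of Koszul's formula for constant coefficient fields, whose brackets
  vanish.\<close>

definition koszul :: "(real^'m \<Rightarrow> real^'m^'m) \<Rightarrow> real^'m::finite \<Rightarrow> real^'m \<Rightarrow> real^'m \<Rightarrow> real^'m \<Rightarrow> real" where
  "koszul G x u v w = 1/2 * (bil (dd G x u) v w + bil (dd G x v) u w - bil (dd G x w) u v)"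

text \<open>Lowering the upper index of the Christoffel symbols with \<open>G x\<close> cancels the
  factor \<open>matrix_inv (G x)\<close>. The resulting identity is checked on basis vectors, first
  in \<open>w\<close> and then in \<open>u\<close> and \<open>v\<close>.\<close>

lemma bil_gam:
  assumes diff: "G differentiable (at x)" and inv: "invertible (G x)"
  shows "bil (G x) w (gam G x u v) = koszul G x u v w"
proof -
  have lin: "linear (dd G x)" by (rule dd_linear[OF diff])
  define K where "K i j = (\<chi> l. koszul G x (axis i 1) (axis j 1) (axis l 1))" for i j
  have "gam G x (axis i 1) (axis j 1) = matrix_inv (G x) *v K i j" for i j
    by (simp add: vec_eq_iff gam_axis christoffel_def matrix_vector_mult_def K_def koszul_def
       pd_nth_nth[OF diff] bil_axis sum_distrib_left mult_ac)
  then have *: "G x *v gam G x (axis i 1) (axis j 1) = K i j" for i j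
    using inv by (simp add: matrix_vector_mul_assoc matrix_inv_right)
  have lw: "linear (koszul G x u v)" for u v
    by (rule linearI) (simp_all add: koszul_def bil_simps bil_matrix_simps linear_add[OF lin]
      linear_cmul[OF lin] algebra_simps)
  have "(\<lambda>w. w \<bullet> K i j) = koszul G x (axis i 1) (axis j 1)" for i j
    by (rule linear_eq_axis)
       (auto simp: lw K_def inner_axis' intro!: linearI inner_add_left)
  then have ax: "bil (G x) w (gam G x (axis i 1) (axis j 1)) = koszul G x (axis i 1) (axis j 1) w" for i j w
    by (simp add: bil_def * fun_eq_iff)
  have "(\<lambda>u v. bil (G x) w (gam G x u v)) = (\<lambda>u v. koszul G x u v w)"
    by (rule bilinear_eq_axis)
       (auto simp: bilinear_def ax gam_simps koszul_def bil_simps bil_matrix_simps linear_add[OF lin]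
      linear_cmul[OF lin] algebra_simps add_divide_distrib diff_divide_distrib intro!: linearI)
  from fun_cong[OF fun_cong[OF this]] show ?thesis by simp
qed

lemma nabla_vec_apply:
  assumes "Y differentiable (at x)"
  shows "nabla_vec G Y x *v X = dd Y x X + gam G x X (Y x)"
proof -
  have "(*v) (nabla_vec G Y x) = (\<lambda>X. dd Y x X + gam G x X (Y x))"
  proof (rule linear_eq_axis)
    fix i
    show "nabla_vec G Y x *v axis i 1 = dd Y x (axis i 1) + gam G x (axis i 1) (Y x)"
      by (simp add: vec_eq_iff matrix_vector_mult_basis column_def nabla_vec_def
          pd_nth[OF assms] gam_axis_left)
  qed (auto intro!: linearI simp: gam_simps linear_add[OF dd_linear[OF assms]]
       linear_cmul[OF dd_linear[OF assms]] algebra_simps)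
  from fun_cong[OF this] show ?thesis by simp
qed

text \<open>For a constant field \<open>Y\<close> this is the Leibniz rule \<open>(\<nabla>\<^sub>X
  P) Y = \<nabla>\<^sub>X (P Y) - P (\<nabla>\<^sub>X Y)\<close>.\<close>

lemma nabla_endo_apply:
  assumes "P differentiable (at x)"
  shows "nabla_endo G P x X *v Y = dd P x X *v Y + gam G x X (P x *v Y) - P x *v gam G x X Y"
proof -
  note lin = linear_add[OF dd_linear[OF assms]] linear_cmul[OF dd_linear[OF assms]]
  define T where "T i k j = pd i (\<lambda>y. P y $ k $ j) x
      + (\<Sum>l\<in>UNIV. christoffel G x k i l * P x $ l $ j)
      - (\<Sum>l\<in>UNIV. christoffel G x l i j * P x $ k $ l)" for i k j
  have nabla: "nabla_endo G P x X = (\<chi> k j. \<Sum>i\<in>UNIV. X $ i * T i k j)" for X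
    by (simp add: nabla_endo_def T_def)
  have "(\<lambda>X Y. nabla_endo G P x X *v Y) =
     (\<lambda>X Y. dd P x X *v Y + gam G x X (P x *v Y) - P x *v gam G x X Y)"
  proof (rule bilinear_eq_axis)
    show "bilinear (\<lambda>X. (*v) (nabla_endo G P x X))"
      by (auto simp: bilinear_def nabla matrix_vector_mult_def vec_eq_iff sum.distrib
         sum_distrib_left sum_distrib_right algebra_simps intro!: linearI)
    show "bilinear (\<lambda>X Y. dd P x X *v Y + gam G x X (P x *v Y) - P x *v gam G x X Y)"
      by (auto simp: bilinear_def gam_simps lin matrix_vector_mult_add_rdistrib
         scaleR_matrix_vector_assoc[symmetric] algebra_simps intro!: linearI)
    fix i j
    show "nabla_endo G P x (axis i 1) *v axis j 1 = dd P x (axis i 1) *v axis j 1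
        + gam G x (axis i 1) (P x *v axis j 1) - P x *v gam G x (axis i 1) (axis j 1)"
      by (simp add: vec_eq_iff matrix_vector_mult_basis column_def nabla T_def
           pd_nth_nth[OF assms] gam_axis_left)
         (simp add: matrix_vector_mult_def gam_axis mult.commute)
  qed
  from fun_cong[OF fun_cong[OF this]] show ?thesis by simp
qed

lemma lie_deriv_metric_nth:
  assumes "X differentiable (at x)" "G differentiable (at x)"
  shows "lie_deriv_metric X G x $ i $ j = bil (dd G x (X x)) (axis i 1) (axis j 1)
    + bil (G x) (dd X x (axis i 1)) (axis j 1) + bil (G x) (axis i 1) (dd X x (axis j 1))"
proof -
  have "dd G x (X x) = (\<Sum>k\<in>UNIV. X x $ k *\<^sub>R dd G x (axis k 1))"
    by (rule linear_axis_expand[OF dd_linear[OF assms(2)]])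
  then show ?thesis
    by (simp add: lie_deriv_metric_def bil_axis pd_nth[OF assms(1)] pd_nth_nth[OF assms(2)] sum.distrib)
       (simp add: bil_def matrix_vector_mult_basis column_def inner_vec_def matrix_vector_mult_def mult.commute
         axis_def if_distrib if_distribR cong: if_cong)
qed

text \<open>The vector \<open>R(u, v) w\<close> for constant fields, where the bracket of
  \<open>u\<close> and \<open>v\<close> vanishes.\<close>

definition riem :: "(real^'m \<Rightarrow> real^'m^'m) \<Rightarrow> real^'m::finite \<Rightarrow> real^'m \<Rightarrow> real^'m \<Rightarrow> real^'m \<Rightarrow> real^'m" where
  "riem G x u v w = dd (\<lambda>y. gam G y v w) x u - dd (\<lambda>y. gam G y u w) x v
     + gam G x u (gam G x v w) - gam G x v (gam G x u w)"

lemma ricci_nth: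
  assumes "\<And>u v. (\<lambda>y. gam G y u v) differentiable (at x)"
  shows "ricci G x $ j $ l = (\<Sum>k\<in>UNIV. riem G x (axis k 1) (axis j 1) (axis l 1) $ k)"
proof -
  have pd: "pd i (\<lambda>y. christoffel G y k j l) x = dd (\<lambda>y. gam G y (axis j 1) (axis l 1)) x (axis i 1) $ k"
    for i j k l
    unfolding gam_axis[symmetric] by (rule pd_nth[OF assms])
  show ?thesis
    by (simp add: ricci_def riemann_def riem_def pd gam_axis gam_axis_left sum_subtractf algebra_simps)
qed

section \<open>Differentiability of the inverse of a matrix-valued map\<close>

lemma differentiable_prod:
  fixes f :: "'i \<Rightarrow> 'v::real_normed_vector \<Rightarrow> real"
  assumes "\<And>i. i \<in> I \<Longrightarrow> f i differentiable (at x)"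
  shows "(\<lambda>y. \<Prod>i\<in>I. f i y) differentiable (at x)"
  using assms by (induction I rule: infinite_finite_induct) auto

lemma differentiable_det:
  fixes A :: "'v::real_normed_vector \<Rightarrow> real^'m^'m::finite"
  assumes "\<And>i j. (\<lambda>y. A y $ i $ j) differentiable (at x)"
  shows "(\<lambda>y. det (A y)) differentiable (at x)"
  unfolding det_def using assms by (intro differentiable_sum ballI differentiable_mult differentiable_prod)
    (auto simp: finite_permutations)

lemma differentiable_componentwise:
  fixes f :: "'v::real_normed_vector \<Rightarrow> 'w::euclidean_space^'n::finite"
  assumes "\<And>k. (\<lambda>y. f y $ k) differentiable (at x)"
  shows "f differentiable (at x)"
  by (subst differentiable_componentwise_within)
     (auto simp: Basis_vec_def inner_axis
        intro: bounded_linear.differentiable[OF bounded_linear_inner_left assms])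

text \<open>Cramer's rule. As quotients of determinants, the entries of the inverse inherit
  differentiability from those of the matrix.\<close>

lemma matrix_inv_nth:
  fixes A :: "real^'m^'m::finite"
  assumes "invertible A"
  shows "matrix_inv A $ k $ l = det (\<chi> i j. if j = k then axis l 1 $ i else A $ i $ j) / det A"
proof -
  have "A *v (matrix_inv A *v axis l 1) = axis l 1"
    using assms by (simp add: matrix_vector_mul_assoc matrix_inv_right)
  then have "matrix_inv A *v axis l 1 = (\<chi> k. det (\<chi> i j. if j = k then axis l 1 $ i else A $ i $ j) / det A)"
    using cramer[of A] assms by (simp add: invertible_det_nz)
  then show ?thesis by (simp add: matrix_vector_mult_basis column_def vec_eq_iff)
qed

section \<open>The Levi-Civita connection of a nondegenerate metric\<close>

locale metric_chart =
  fixes S :: "(real^'m::finite) set" and G :: "real^'m \<Rightarrow> real^'m^'m"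
  assumes open_S: "open S" and smooth_G: "smooth_on S G"
    and sym_G: "x \<in> S \<Longrightarrow> bil (G x) u v = bil (G x) v u"
    and nondeg_G: "x \<in> S \<Longrightarrow> (\<And>v. bil (G x) u v = 0) \<Longrightarrow> u = 0"
begin

lemma diff_G: "x \<in> S \<Longrightarrow> G differentiable (at x)"
  using smooth_on_differentiable[OF smooth_G] .

lemma invertible_G:
  assumes "x \<in> S"
  shows "invertible (G x)"
  unfolding invertible_left_inverse matrix_left_invertible_ker
proof (intro allI impI)
  fix u assume "G x *v u = 0"
  then have "bil (G x) u v = 0" for v
    using sym_G[OF assms, of u v] by (simp add: bil_def)
  then show "u = 0" using nondeg_G[OF assms] by blast
qed

lemmas bil_gam_S = bil_gam[OF diff_G invertible_G]

text \<open>Nondegeneracy recognises a vector by its pairings, so a candidate only has to satisfy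
  Koszul's formula. The connection of the deformed metric is verified in this way.\<close>

lemma gam_unique:
  assumes "x \<in> S" "\<And>w. bil (G x) w h = koszul G x u v w"
  shows "gam G x u v = h"
proof -
  have "bil (G x) (gam G x u v - h) w = 0" for w
    using assms(2)[of w] bil_gam_S[OF assms(1) assms(1), of w u v]
    by (simp add: sym_G[OF assms(1), of _ w] bil_simps)
  then show ?thesis using nondeg_G[OF assms(1), of "gam G x u v - h"] by simp
qed

lemma sym_dd_G:
  assumes "x \<in> S"
  shows "bil (dd G x w) u v = bil (dd G x w) v u"
proof -
  have "dd (\<lambda>y. bil (G y) u v) x w = dd (\<lambda>y. bil (G y) v u) x w"
    by (rule fun_cong[OF dd_cong[OF open_S assms]]) (rule sym_G)
  then show ?thesis
    by (simp add: bounded_linear.dd[OF bounded_linear_bil diff_G[OF assms]])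
qed

lemma gam_sym: "x \<in> S \<Longrightarrow> gam G x u v = gam G x v u"
  by (rule gam_unique) (simp_all add: bil_gam_S koszul_def sym_dd_G[of x _ u v])

text \<open>In the sum of the two Koszul expressions everything cancels except the derivative in
  direction \<open>u\<close>.\<close>

lemma metric_compatible:
  "x \<in> S \<Longrightarrow> bil (dd G x u) v w = bil (G x) (gam G x u v) w + bil (G x) v (gam G x u w)"
  by (simp add: sym_G[of x "gam G x u v" w] bil_gam_S koszul_def sym_dd_G[of x u w v] field_simps)

text \<open>Metric compatibility turns the derivative of \<open>G\<close> along \<open>X\<close>
  into Christoffel terms, and torsion-freeness merges them with the derivatives of \<open>X\<close>.
  Thus \<open>X\<close> is Killing if its covariant derivative is skew.\<close>

lemma lie_deriv_eq:
  assumes "x \<in> S" "X differentiable (at x)"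
  shows "lie_deriv_metric X G x $ i $ j = bil (G x) (nabla_vec G X x *v axis i 1) (axis j 1)
    + bil (G x) (axis i 1) (nabla_vec G X x *v axis j 1)"
  by (simp add: lie_deriv_metric_nth[OF assms(2) diff_G[OF assms(1)]] nabla_vec_apply[OF assms(2)]
     metric_compatible[OF assms(1)] bil_simps gam_sym[OF assms(1), of "X x"])

text \<open>Each component is a finite sum of products of entries of the inverse, handled by
  Cramer's rule, with first derivatives of the smooth \<open>G\<close>.\<close>

lemma diff_gam:
  assumes "x \<in> S"
  shows "(\<lambda>y. gam G y u v) differentiable (at x)"
proof -
  have Gn: "(\<lambda>y. G y $ i $ j) differentiable (at y)" if "y \<in> S" for i j y
    by (intro bounded_linear.differentiable[OF bounded_linear_vec_nth] diff_G that)
  have "(\<lambda>y. det (\<chi> i j. if j = k then axis l 1 $ i else G y $ i $ j)) differentiable (at x)" for k l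
  proof (rule differentiable_det)
    fix i j show "(\<lambda>y. (\<chi> i j. if j = k then axis l 1 $ i else G y $ i $ j) $ i $ j) differentiable (at x)"
      using Gn[OF assms] by (cases "j = k") auto
  qed
  then have quot: "(\<lambda>y. det (\<chi> i j. if j = k then axis l 1 $ i else G y $ i $ j) / det (G y)) differentiable (at x)" for k l
    using invertible_G[OF assms] differentiable_det[OF Gn[OF assms]]
    by (intro differentiable_divide) (auto simp: invertible_det_nz)
  have inv: "(\<lambda>y. matrix_inv (G y) $ k $ l) differentiable (at x)" for k l
    by (rule differentiable_cong_open[OF open_S assms _ quot[of k l]]) (simp add: matrix_inv_nth invertible_G)
  have pdG: "(\<lambda>y. pd i (\<lambda>y. G y $ k $ l) y) differentiable (at x)" for i k l
  proof (rule differentiable_cong_open[OF open_S assms])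
    show "(\<lambda>y. dd G y (axis i 1) $ k $ l) differentiable (at x)"
      by (intro bounded_linear.differentiable[OF bounded_linear_vec_nth]
         smooth_on_differentiable[OF smooth_on_dd[OF smooth_G]] assms)
  qed (simp add: pd_nth_nth diff_G)
  show ?thesis
    by (rule differentiable_componentwise)
       (simp add: gam_def christoffel_def inv pdG)
qed

end

section \<open>Sasakian structures in a chart\<close>

lemma neg_matrix_vector_mult: "(- A) *v v = - (A *v (v :: real^'m::finite))"
  by (simp add: vec_eq_iff matrix_vector_mult_def sum_negf)

lemma matrix_vector_mult_neg: "A *v (- v) = - (A *v (v :: real^'m::finite))"
  by (simp add: vec_eq_iff matrix_vector_mult_def sum_negf)

lemmas mult_vec_simps = matrix_vector_right_distrib matrix_vector_mult_diff_distrib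
  matrix_vector_mult_add_rdistrib matrix_vector_mult_diff_rdistrib matrix_vector_mult_scaleR
  neg_matrix_vector_mult matrix_vector_mult_neg

lemma bounded_bilinear_outer_product:
  "bounded_bilinear (\<lambda>u v. (\<chi> i j. u $ i * v $ j) :: real^'m^'m::finite)"
  unfolding bilinear_conv_bounded_bilinear[symmetric] bilinear_def
  by (auto intro!: linearI simp: vec_eq_iff algebra_simps)

lemma smooth_on_outer: "open S \<Longrightarrow> smooth_on S f \<Longrightarrow> smooth_on S (\<lambda>x. outer (f x))"
  unfolding outer_def by (rule bounded_bilinear.smooth_on[OF bounded_bilinear_outer_product])

lemma bil_outer: "bil (outer w) u v = (w \<bullet> u) * (w \<bullet> v)"
proof -
  have "outer w *v v = (w \<bullet> v) *\<^sub>R w"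
    by (simp add: outer_def vec_eq_iff inner_vec_def matrix_vector_mult_def sum_distrib_left mult_ac)
  then show ?thesis by (simp add: bil_def inner_commute)
qed

lemma bounded_linear_mult_vec_left: "bounded_linear (\<lambda>A. A *v (v :: real^'m::finite))"
  by (rule bounded_bilinear.bounded_linear_left[OF bounded_bilinear_mult_vec])

lemma dd_bil:
  assumes "G differentiable (at x)" "U differentiable (at x)" "V differentiable (at x)"
  shows "dd (\<lambda>y. bil (G y) (U y) (V y)) x w
    = bil (dd G x w) (U x) (V x) + bil (G x) (dd U x w) (V x) + bil (G x) (U x) (dd V x w)"
proof -
  have GV: "(\<lambda>y. G y *v V y) differentiable (at x)"
    by (rule bounded_bilinear.differentiable[OF bounded_bilinear_mult_vec assms(1,3)])
  show ?thesis
    unfolding bil_def bounded_bilinear.dd[OF bounded_bilinear_inner assms(2) GV]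
      bounded_bilinear.dd[OF bounded_bilinear_mult_vec assms(1,3)]
    by (simp add: inner_add_right)
qed

text \<open>For fixed \<open>v\<close>, \<open>gam G y v\<close> is multiplication by a matrix
  \<open>N y\<close> that is differentiable at \<open>x\<close>, so the product rule
  applies.\<close>

lemma (in metric_chart) dd_gam_field:
  assumes "x \<in> S" "X differentiable (at x)"
  shows "dd (\<lambda>y. gam G y v (X y)) x u = dd (\<lambda>y. gam G y v (X x)) x u + gam G x v (dd X x u)"
proof -
  define N where "N y = matrix (gam G y v)" for y
  have N: "gam G y v w = N y *v w" for y w
    using bilinear_gam[of G y] unfolding N_def bilinear_def by (simp add: matrix_works)
  have "N differentiable (at x)"
  proof (rule differentiable_componentwise)
    fix k
    show "(\<lambda>y. N y $ k) differentiable (at x)"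
    proof (rule differentiable_componentwise)
      fix j
      have "(\<lambda>y. gam G y v (axis j 1) $ k) differentiable (at x)"
        by (intro bounded_linear.differentiable[OF bounded_linear_vec_nth] diff_gam assms)
      then show "(\<lambda>y. N y $ k $ j) differentiable (at x)" by (simp add: N_def matrix_def)
    qed
  qed
  then show ?thesis
    unfolding N using assms(2)
    by (simp add: bounded_bilinear.dd[OF bounded_bilinear_mult_vec]
        bounded_linear.dd[OF bounded_linear_mult_vec_left])
qed

lemma (in metric_chart) linear_riem:
  assumes "x \<in> S" shows "linear (riem G x u v)"
proof (rule linearI)
  show "riem G x u v (w + w') = riem G x u v w + riem G x u v w'" for w w'
    by (simp add: riem_def gam_simps dd_add diff_gam assms)
  show "riem G x u v (c *\<^sub>R w) = c *\<^sub>R riem G x u v w" for c w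
    by (simp add: riem_def gam_simps bounded_linear.dd[OF bounded_linear_scaleR_right] diff_gam assms
       scaleR_diff_right scaleR_add_right)
qed

lemma (in metric_chart) ricci_mult_vec:
  assumes "x \<in> S"
  shows "(ricci G x *v w) $ j = (\<Sum>k\<in>UNIV. riem G x (axis k 1) (axis j 1) w $ k)"
proof -
  have "riem G x u v w $ k = (\<Sum>l\<in>UNIV. w $ l * riem G x u v (axis l 1) $ k)" for u v k
    using arg_cong[OF linear_axis_expand[OF linear_riem[OF assms], of u v w], of "\<lambda>z. z $ k"] by simp
  then have "(\<Sum>k\<in>UNIV. riem G x (axis k 1) (axis j 1) w $ k)
     = (\<Sum>k\<in>UNIV. \<Sum>l\<in>UNIV. w $ l * riem G x (axis k 1) (axis j 1) (axis l 1) $ k)" by simp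
  also have "\<dots> = (\<Sum>l\<in>UNIV. \<Sum>k\<in>UNIV. w $ l * riem G x (axis k 1) (axis j 1) (axis l 1) $ k)"
    by (rule sum.swap)
  finally show ?thesis
    by (simp add: matrix_vector_mult_def ricci_nth[OF diff_gam[OF assms]] sum_distrib_left mult.commute)
qed

section \<open>Pointwise consequences of the Sasakian identities\<close>

locale sasakian_chart =
  fixes S :: "(real^'m::finite) set" and \<xi> \<eta> :: "real^'m \<Rightarrow> real^'m"
    and \<Phi> G :: "real^'m \<Rightarrow> real^'m^'m"
  assumes open_S: "open S" and smooth_G: "smooth_on S G" and smooth_Phi: "smooth_on S \<Phi>"
    and smooth_xi: "smooth_on S \<xi>" and smooth_eta: "smooth_on S \<eta>"
    and sym_G: "x \<in> S \<Longrightarrow> bil (G x) u v = bil (G x) v u"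
    and pos_G: "x \<in> S \<Longrightarrow> u \<noteq> 0 \<Longrightarrow> bil (G x) u u > 0"
    and eta_xi: "x \<in> S \<Longrightarrow> \<eta> x \<bullet> \<xi> x = 1"
    and Phi_Phi: "x \<in> S \<Longrightarrow> \<Phi> x *v (\<Phi> x *v u) = - u + (\<eta> x \<bullet> u) *\<^sub>R \<xi> x"
    and G_Phi_Phi: "x \<in> S \<Longrightarrow> bil (G x) (\<Phi> x *v u) (\<Phi> x *v v) = bil (G x) u v - (\<eta> x \<bullet> u) * (\<eta> x \<bullet> v)"
    and nabla_Phi: "x \<in> S \<Longrightarrow> nabla_endo G \<Phi> x u *v v = bil (G x) u v *\<^sub>R \<xi> x - (\<eta> x \<bullet> v) *\<^sub>R u"

sublocale sasakian_chart \<subseteq> metric_chart S G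
proof unfold_locales
  fix x u assume "x \<in> S" "\<And>v. bil (G x) u v = 0"
  then show "u = 0" using pos_G[of x u] by force
qed (rule open_S smooth_G sym_G; assumption)+

context sasakian_chart
begin

lemma diffs:
  assumes "x \<in> S"
  shows "\<Phi> differentiable (at x)" "\<xi> differentiable (at x)" "\<eta> differentiable (at x)"
  using smooth_on_differentiable[OF _ assms] smooth_Phi smooth_xi smooth_eta by blast+

text \<open>Since \<open>\<Phi>\<^sup>2 \<xi> = 0\<close>, the formula for
  \<open>\<Phi>\<^sup>2\<close> applied to \<open>\<Phi> \<xi>\<close> gives
  \<open>\<Phi> \<xi> = \<mu> \<xi>\<close>; then \<open>\<mu>\<^sup>2 \<xi> = 0\<close> with \<xi>
  nonzero.\<close>

lemma Phi_xi: assumes "x \<in> S" shows "\<Phi> x *v \<xi> x = 0"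
proof -
  have 0: "\<Phi> x *v (\<Phi> x *v \<xi> x) = 0" by (simp add: Phi_Phi eta_xi assms)
  define \<mu> where "\<mu> = \<eta> x \<bullet> (\<Phi> x *v \<xi> x)"
  have "0 = \<Phi> x *v (\<Phi> x *v (\<Phi> x *v \<xi> x))" by (simp add: 0)
  also have "\<dots> = - (\<Phi> x *v \<xi> x) + \<mu> *\<^sub>R \<xi> x" by (simp only: Phi_Phi[OF assms, of "\<Phi> x *v \<xi> x"] \<mu>_def)
  finally have 1: "\<Phi> x *v \<xi> x = \<mu> *\<^sub>R \<xi> x" by simp
  then have "(\<mu> * \<mu>) *\<^sub>R \<xi> x = 0" using 0 by (simp add: mult_vec_simps)
  moreover have "\<xi> x \<noteq> 0" using eta_xi[OF assms] by auto
  ultimately show ?thesis using 1 by simp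
qed

text \<open>Expanding \<open>\<Phi>\<^sup>3 u\<close> as \<open>\<Phi>\<^sup>2 (\<Phi> u)\<close>
  and as \<open>\<Phi> (\<Phi>\<^sup>2 u)\<close> leaves a multiple of \<xi> that must
  vanish.\<close>

lemma eta_Phi: assumes "x \<in> S" shows "\<eta> x \<bullet> (\<Phi> x *v u) = 0"
proof -
  have "\<Phi> x *v (\<Phi> x *v (\<Phi> x *v u)) = - (\<Phi> x *v u) + (\<eta> x \<bullet> (\<Phi> x *v u)) *\<^sub>R \<xi> x"
    by (rule Phi_Phi[OF assms])
  moreover have "\<Phi> x *v (\<Phi> x *v (\<Phi> x *v u)) = \<Phi> x *v (- u + (\<eta> x \<bullet> u) *\<^sub>R \<xi> x)"
    by (simp only: Phi_Phi[OF assms])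
  ultimately have "(\<eta> x \<bullet> (\<Phi> x *v u)) *\<^sub>R \<xi> x = 0"
    by (simp add: mult_vec_simps Phi_xi assms)
  moreover have "\<xi> x \<noteq> 0" using eta_xi[OF assms] by auto
  ultimately show ?thesis by simp
qed

lemma G_xi: assumes "x \<in> S" shows "bil (G x) (\<xi> x) v = \<eta> x \<bullet> v" "bil (G x) v (\<xi> x) = \<eta> x \<bullet> v"
  using G_Phi_Phi[OF assms, of "\<xi> x" v] sym_G[OF assms, of v]
  by (simp_all add: Phi_xi eta_xi assms bil_simps)

text \<open>Put \<open>\<Phi> v\<close> for \<open>v\<close> in the compatibility of
  \<open>G\<close> with \<Phi>; \<eta> kills the image of \<Phi>.\<close>

lemma Phi_skew: assumes "x \<in> S" shows "bil (G x) (\<Phi> x *v u) v = - bil (G x) u (\<Phi> x *v v)"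
  using G_Phi_Phi[OF assms, of u "\<Phi> x *v v"]
  by (simp add: Phi_Phi eta_Phi G_xi assms bil_simps)

text \<open>Differentiating \<open>\<Phi> \<xi> = 0\<close> determines \<open>\<nabla> \<xi>\<close> up to multiples of \<open>\<xi>\<close>, and differentiating
  \<open>g(\<xi>, \<xi>) = 1\<close> removes this ambiguity.\<close>

lemma dd_xi: assumes "x \<in> S" shows "dd \<xi> x u = - (\<Phi> x *v u) - gam G x u (\<xi> x)"
proof -
  define N where "N = dd \<xi> x u + gam G x u (\<xi> x)"
  have "dd (\<lambda>y. \<Phi> y *v \<xi> y) x u = dd (\<lambda>y. 0) x u"
    by (rule fun_cong[OF dd_cong[OF open_S assms]]) (rule Phi_xi)
  then have "dd \<Phi> x u *v \<xi> x = - (\<Phi> x *v dd \<xi> x u)"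
    by (simp add: bounded_bilinear.dd[OF bounded_bilinear_mult_vec] diffs assms eq_neg_iff_add_eq_0 add.commute)
  then have "- (\<Phi> x *v dd \<xi> x u) - \<Phi> x *v gam G x u (\<xi> x) = (\<eta> x \<bullet> u) *\<^sub>R \<xi> x - u"
    using nabla_Phi[OF assms, of u "\<xi> x"]
    by (simp add: nabla_endo_apply diffs assms Phi_xi gam_simps G_xi eta_xi)
  moreover have "\<Phi> x *v N = - (- (\<Phi> x *v dd \<xi> x u) - \<Phi> x *v gam G x u (\<xi> x))"
    by (simp add: N_def mult_vec_simps)
  ultimately have "\<Phi> x *v N = u - (\<eta> x \<bullet> u) *\<^sub>R \<xi> x" by simp
  then have "\<Phi> x *v (\<Phi> x *v N) = \<Phi> x *v u"
    by (simp add: mult_vec_simps Phi_xi assms)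
  then have 1: "- N + (\<eta> x \<bullet> N) *\<^sub>R \<xi> x = \<Phi> x *v u" by (simp add: Phi_Phi assms)
  have "dd (\<lambda>y. bil (G y) (\<xi> y) (\<xi> y)) x u = dd (\<lambda>y. 1) x u"
    by (rule fun_cong[OF dd_cong[OF open_S assms]]) (simp add: G_xi eta_xi)
  then have "bil (G x) N (\<xi> x) + bil (G x) (\<xi> x) N = 0"
    by (simp add: dd_bil diff_G diffs assms metric_compatible N_def bil_simps)
  then have "\<eta> x \<bullet> N = 0" by (simp add: G_xi assms)
  then have "N = - (\<Phi> x *v u)" using 1 minus_equation_iff[of N] by simp
  then show ?thesis by (simp add: N_def eq_diff_eq)
qed

lemma dd_Phi:
  assumes "x \<in> S"
  shows "dd \<Phi> x u *v v = bil (G x) u v *\<^sub>R \<xi> x - (\<eta> x \<bullet> v) *\<^sub>R u - gam G x u (\<Phi> x *v v) + \<Phi> x *v gam G x u v"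
  using nabla_Phi[OF assms, of u v]
  by (simp add: nabla_endo_apply diffs assms algebra_simps)

text \<open>As \<eta> is dual to \<xi> and the metric is parallel, \<open>(\<nabla>\<^sub>u \<eta>)
  v = g(\<nabla>\<^sub>u \<xi>, v) = - g(\<Phi> u, v)\<close>; skewness moves \<Phi> to
  \<open>v\<close>.\<close>

lemma dd_eta:
  assumes "x \<in> S"
  shows "dd \<eta> x u \<bullet> v = bil (G x) u (\<Phi> x *v v) + \<eta> x \<bullet> gam G x u v"
proof -
  have "dd (\<lambda>y. \<eta> y \<bullet> v) x u = dd (\<lambda>y. bil (G y) (\<xi> y) v) x u"
    by (rule fun_cong[OF dd_cong[OF open_S assms]]) (simp add: G_xi)
  moreover have "dd (\<lambda>y. \<eta> y \<bullet> v) x u = dd \<eta> x u \<bullet> v"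
    by (rule bounded_linear.dd[OF bounded_linear_inner_left diffs(3)[OF assms]])
  ultimately show ?thesis
    by (simp add: dd_bil diff_G diffs assms metric_compatible dd_xi bil_simps G_xi Phi_skew)
qed

text \<open>Differentiate \<open>\<nabla> \<xi> = - \<Phi>\<close> and antisymmetrise. The second
  derivatives of \<xi> cancel, leaving
  \<open>(\<nabla>\<^sub>v \<Phi>) u - (\<nabla>\<^sub>u \<Phi>) v\<close>, which the Sasakian
  identity evaluates.\<close>

lemma riem_xi:
  assumes "x \<in> S"
  shows "riem G x u v (\<xi> x) = (\<eta> x \<bullet> v) *\<^sub>R u - (\<eta> x \<bullet> u) *\<^sub>R v"
proof -
  have *: "dd (\<lambda>y. gam G y v (\<xi> x)) x u = - (dd \<Phi> x u *v v) - dd (\<lambda>y. dd \<xi> y v) x u - gam G x v (dd \<xi> x u)"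
    for u v
  proof -
    have d: "(\<lambda>y. dd \<xi> y v) differentiable (at x)" "(\<lambda>y. \<Phi> y *v v) differentiable (at x)"
      by (rule smooth_on_differentiable[OF smooth_on_dd[OF smooth_xi] assms])
         (rule bounded_linear.differentiable[OF bounded_linear_mult_vec_left diffs(1)[OF assms]])
    have "dd (\<lambda>y. gam G y v (\<xi> y)) x u = dd (\<lambda>y. - (\<Phi> y *v v + dd \<xi> y v)) x u"
      by (rule fun_cong[OF dd_cong[OF open_S assms]]) (simp add: dd_xi)
    also have "\<dots> = - (dd \<Phi> x u *v v) - dd (\<lambda>y. dd \<xi> y v) x u"
      unfolding dd_minus[OF differentiable_add[OF d(2,1)]] dd_add[OF d(2,1)]
        bounded_linear.dd[OF bounded_linear_mult_vec_left diffs(1)[OF assms]] by simp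
    finally show ?thesis by (simp add: dd_gam_field[OF assms diffs(2)[OF assms]] algebra_simps)
  qed
  have "riem G x u v (\<xi> x) = (- (dd \<Phi> x u *v v) - gam G x v (dd \<xi> x u))
     - (- (dd \<Phi> x v *v u) - gam G x u (dd \<xi> x v))
     + gam G x u (gam G x v (\<xi> x)) - gam G x v (gam G x u (\<xi> x))"
    unfolding riem_def * using dd_commute[OF open_S assms smooth_xi, of u v] by simp
  also have "\<dots> = (\<eta> x \<bullet> v) *\<^sub>R u - (\<eta> x \<bullet> u) *\<^sub>R v"
    by (simp add: dd_Phi dd_xi assms gam_simps gam_sym[OF assms, of v u] sym_G[OF assms, of v u])
  finally show ?thesis .
qed

text \<open>The endomorphism \<open>u \<mapsto> \<eta>(v) u - \<eta>(u) v\<close> has trace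
  \<open>(CARD('m) - 1) \<eta>(v)\<close>.\<close>

lemma ricci_xi:
  assumes "x \<in> S"
  shows "ricci G x *v \<xi> x = (real CARD('m) - 1) *\<^sub>R \<eta> x"
proof -
  have "(\<Sum>k\<in>UNIV. \<eta> x $ k * axis j 1 $ k) = \<eta> x $ j" for j
    by (rule sum_axis)
  then show ?thesis
    by (simp add: vec_eq_iff ricci_mult_vec[OF assms] riem_xi[OF assms] sum_subtractf inner_axis algebra_simps)
qed

end

section \<open>The Lorentzian deformation\<close>

text \<open>The trace of the rank-one endomorphism \<open>X \<mapsto> B(X, u) v\<close>, a frequent
  shape among the terms of the deformed curvature.\<close>

lemma sum_bil_axis: "(\<Sum>k\<in>UNIV. bil B (axis k 1) u * v $ k) = bil B v u"
  by (simp add: bil_def inner_axis' inner_vec_def mult.commute)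

lemma sum_inner_axis: "(\<Sum>k\<in>UNIV. (u \<bullet> axis k 1) * v $ k) = u \<bullet> (v :: real^'m::finite)"
  by (simp add: inner_axis inner_vec_def)

section \<open>The deformed metric and its signature\<close>

definition deformed_metric ::
  "real \<Rightarrow> (real^'m::finite \<Rightarrow> real^'m) \<Rightarrow> (real^'m \<Rightarrow> real^'m^'m) \<Rightarrow> real^'m \<Rightarrow> real^'m^'m" where
  "deformed_metric a \<eta> G y = - (a *\<^sub>R G y + (a * (a - 1)) *\<^sub>R outer (\<eta> y))"

definition deformed_field :: "real \<Rightarrow> (real^'m::finite \<Rightarrow> real^'m) \<Rightarrow> real^'m \<Rightarrow> real^'m" where
  "deformed_field a \<xi> y = inverse a *\<^sub>R \<xi> y"

lemma bil_deformed_metric: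
  "bil (deformed_metric a \<eta> G y) u v
    = - (a * bil (G y) u v + a * (a - 1) * ((\<eta> y \<bullet> u) * (\<eta> y \<bullet> v)))"
  unfolding deformed_metric_def bil_matrix_simps bil_outer ..

locale deformed_sasakian_chart = sasakian_chart S \<xi> \<eta> \<Phi> G
  for S :: "(real^'m::finite) set" and \<xi> \<eta> \<Phi> G +
  fixes a :: real
  assumes a_neg: "a < 0"
begin

abbreviation G' where "G' \<equiv> deformed_metric a \<eta> G"

abbreviation xi' where "xi' \<equiv> deformed_field a \<xi>"

lemmas bil_G' = bil_deformed_metric[of a \<eta> G]

lemma bil_G'_xi': assumes "x \<in> S" shows "bil (G' x) u (xi' x) = - a * (\<eta> x \<bullet> u)"
  using a_neg by (simp add: bil_G' deformed_field_def bil_simps G_xi eta_xi assms field_simps)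

lemma smooth_G': "smooth_on S G'"
proof -
  have "G' = (\<lambda>y. - a *\<^sub>R G y + (- (a * (a - 1))) *\<^sub>R outer (\<eta> y))" by (simp add: fun_eq_iff deformed_metric_def)
  then show ?thesis
    by (simp only:) (intro smooth_on_add bounded_linear.smooth_on[OF bounded_linear_scaleR_right]
       smooth_on_outer open_S smooth_G smooth_eta)
qed

lemma smooth_xi': "smooth_on S xi'"
  unfolding deformed_field_def[abs_def]
  by (intro bounded_linear.smooth_on[OF bounded_linear_scaleR_right] open_S smooth_xi)

text \<open>Pairing with \<open>xi' x\<close> gives \<open>\<eta>(u) = 0\<close>; pairing with
  \<open>u\<close> then leaves \<open>- a G(u, u)\<close>.\<close>

lemma nondeg_G':
  assumes "x \<in> S" "\<And>v. bil (G' x) u v = 0"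
  shows "u = 0"
proof (rule ccontr)
  assume "u \<noteq> 0"
  have "\<eta> x \<bullet> u = 0" using bil_G'_xi'[OF assms(1), of u] assms(2)[of "xi' x"] a_neg by simp
  then have "a * bil (G x) u u = 0" using assms(2)[of u] by (simp add: bil_G')
  then show False using pos_G[OF assms(1) \<open>u \<noteq> 0\<close>] a_neg by simp
qed

lemma metric_chart_G': "metric_chart S G'"
  by unfold_locales (auto simp: open_S smooth_G' bil_G' sym_G mult.commute nondeg_G' intro: nondeg_G')

text \<open>\<open>metric_chart\<close> asks for nondegeneracy rather than positivity, so its
  Levi-Civita calculus also serves the Lorentzian metric.\<close>

sublocale G': metric_chart S G'
  by (rule metric_chart_G')

text \<open>The value on \<xi> is \<open>- a\<^sup>2\<close>, so the line of \<xi> is negative. On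
  the kernel of \<eta> the form is \<open>- a G\<close>, positive because \<open>a < 0\<close>;
  hence \<eta> is injective on every negative subspace, which has dimension at most 1.\<close>

lemma form_index_G':
  assumes "x \<in> S"
  shows "form_index (G' x) = 1"
proof -
  let ?D = "{dim W | W. subspace W \<and> (\<forall>w\<in>W. w \<noteq> 0 \<longrightarrow> bil (G' x) w w < 0)}"
  have xi0: "\<xi> x \<noteq> 0" using eta_xi[OF assms] by auto
  have neg: "bil (G' x) w w < 0" if "w \<in> span {\<xi> x}" "w \<noteq> 0" for w
  proof -
    obtain c where c: "w = c *\<^sub>R \<xi> x" using \<open>w \<in> _\<close> by (auto simp: span_singleton)
    then have "bil (G' x) w w = - ((a * c)\<^sup>2)"
      by (simp add: bil_G' bil_simps G_xi eta_xi assms power2_eq_square algebra_simps)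
    moreover have "a * c \<noteq> 0" using c \<open>w \<noteq> 0\<close> a_neg by auto
    ultimately show ?thesis by simp
  qed
  have "dim (span {\<xi> x}) = 1" using xi0 by (simp add: dim_span dim_singleton)
  then have one: "1 \<in> ?D"
    using neg by (intro CollectI exI[of _ "span {\<xi> x}"]) (auto simp: subspace_span)
  have le1: "d \<le> 1" if "d \<in> ?D" for d
  proof -
    from that obtain W where W: "d = dim W" "subspace W" "\<And>w. w \<in> W \<Longrightarrow> w \<noteq> 0 \<Longrightarrow> bil (G' x) w w < 0"
      by auto
    have lin: "linear (\<lambda>w. \<eta> x \<bullet> w)" by (intro linearI) (auto simp: inner_simps)
    have "w = 0" if "w \<in> W" "\<eta> x \<bullet> w = 0" for w
    proof (rule ccontr)
      assume "w \<noteq> 0"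
      from W(3)[OF that(1) this] have "0 < a * bil (G x) w w" by (simp add: bil_G' that(2))
      then show False using a_neg pos_G[OF assms \<open>w \<noteq> 0\<close>] by (simp add: zero_less_mult_iff)
    qed
    then have "inj_on (\<lambda>w. \<eta> x \<bullet> w) W"
      using linear_injective_on_subspace_0[OF lin W(2)] by blast
    then have "dim ((\<lambda>w. \<eta> x \<bullet> w) ` W) = dim W"
      by (intro dim_image_eq lin) (simp add: real_vector.span_eq_iff[THEN iffD2, OF W(2)])
    moreover have "dim ((\<lambda>w. \<eta> x \<bullet> w) ` W) \<le> 1"
      using dim_subset_UNIV[of "(\<lambda>w. \<eta> x \<bullet> w) ` W"] by simp
    ultimately show ?thesis using W(1) by simp
  qed
  then have "?D \<subseteq> {..1}" by blast
  then have "Max ?D = 1"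
    using one le1 by (intro Max_eqI finite_subset[OF _ finite_atMost])
  then show ?thesis by (simp add: form_index_def)
qed

section \<open>The connection of the deformed metric\<close>

lemma dd_G': assumes "x \<in> S"
  shows "bil (dd G' x u) v w = - (a * bil (dd G x u) v w
    + a * (a - 1) * ((dd \<eta> x u \<bullet> v) * (\<eta> x \<bullet> w) + (\<eta> x \<bullet> v) * (dd \<eta> x u \<bullet> w)))"
proof -
  have eta: "((\<lambda>y. \<eta> y \<bullet> v) has_derivative (\<lambda>u. dd \<eta> x u \<bullet> v)) (at x)" for v
    by (rule bounded_linear.has_derivative[OF bounded_linear_inner_left has_derivative_dd[OF diffs(3)[OF assms]]])
  have G: "((\<lambda>y. bil (G y) v w) has_derivative (\<lambda>u. bil (dd G x u) v w)) (at x)"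
    by (rule bounded_linear.has_derivative[OF bounded_linear_bil has_derivative_dd[OF diff_G[OF assms]]])
  have "((\<lambda>y. bil (G' y) v w) has_derivative (\<lambda>u. - (a * bil (dd G x u) v w
    + a * (a - 1) * ((dd \<eta> x u \<bullet> v) * (\<eta> x \<bullet> w) + (\<eta> x \<bullet> v) * (dd \<eta> x u \<bullet> w))))) (at x)"
    unfolding bil_G' by (rule derivative_eq_intros G eta refl)+ (simp add: fun_eq_iff algebra_simps)
  from dd_eqI[OF this] show ?thesis
    by (simp add: bounded_linear.dd[OF bounded_linear_bil G'.diff_G[OF assms], symmetric])
qed

text \<open>In Koszul's formula the derivative of \<open>\<eta> \<otimes> \<eta>\<close> yields
  Christoffel terms, absorbed by \<open>gam G\<close>, and terms like
  \<open>\<eta>(u) g(v, \<Phi> w)\<close>. Skewness of \<Phi> collects the latter into the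
  correction, on which \<eta> vanishes.\<close>

lemma gam_G':
  assumes "x \<in> S"
  shows "gam G' x u v = gam G x u v
    + (1 - a) *\<^sub>R ((\<eta> x \<bullet> u) *\<^sub>R (\<Phi> x *v v) + (\<eta> x \<bullet> v) *\<^sub>R (\<Phi> x *v u))"
proof (rule G'.gam_unique[OF assms])
  fix w
  \<comment> \<open>As a general rewrite rule this would apply again to its own right side, so the
    simplifier receives chosen instances.\<close>
  have sk: "bil (G x) w (\<Phi> x *v v) = - bil (G x) v (\<Phi> x *v w)" for v w
    using Phi_skew[OF assms, of v w] sym_G[OF assms] by simp
  have s: "bil (G x) (gam G x w v) u = bil (G x) u (gam G x w v)" for u v w
    by (rule sym_G[OF assms])
  show "bil (G' x) w (gam G x u v
      + (1 - a) *\<^sub>R ((\<eta> x \<bullet> u) *\<^sub>R (\<Phi> x *v v) + (\<eta> x \<bullet> v) *\<^sub>R (\<Phi> x *v u))) = koszul G' x u v w"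
    unfolding koszul_def dd_G'[OF assms] bil_G'
    by (simp add: dd_eta assms metric_compatible s bil_simps inner_simps eta_Phi gam_sym[OF assms, of w]
         gam_sym[OF assms, of v u] sk[of v w] sk[of u w] sk[of v u])
       (simp add: field_simps)
qed

text \<open>At \<xi> the correction is \<open>(1 - a) \<Phi> u\<close>, which turns
  \<open>- \<Phi> u\<close> into \<open>- a \<Phi> u\<close>; the scaling of \<open>xi'\<close>
  cancels \<open>a\<close>.\<close>

lemma nabla_vec_G':
  assumes "x \<in> S"
  shows "nabla_vec G' xi' x = - \<Phi> x"
proof -
  have "xi' differentiable (at x)" by (rule smooth_on_differentiable[OF smooth_xi' assms])
  moreover have "dd xi' x u = inverse a *\<^sub>R dd \<xi> x u" for u
    unfolding deformed_field_def[abs_def] by (rule bounded_linear.dd[OF bounded_linear_scaleR_right diffs(2)[OF assms]])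
  ultimately have "nabla_vec G' xi' x *v u = inverse a *\<^sub>R (dd \<xi> x u + gam G' x u (\<xi> x))" for u
    by (simp add: nabla_vec_apply deformed_field_def gam_simps scaleR_add_right)
  moreover have "dd \<xi> x u + gam G' x u (\<xi> x) = - (a *\<^sub>R (\<Phi> x *v u))" for u
    by (simp add: gam_G' assms dd_xi Phi_xi eta_xi scaleR_diff_left)
  ultimately show ?thesis using a_neg by (simp add: matrix_eq neg_matrix_vector_mult)
qed

text \<open>The two corrections with \<open>\<Phi>\<^sup>2 v\<close> cancel, and
  \<open>(1 - a) \<eta>(v) \<Phi>\<^sup>2 u\<close> is added to
  \<open>- (\<nabla>\<^sub>u \<Phi>) v\<close>. Both sides are brought to one normal form.\<close>

lemma nabla_endo_G':
  assumes "x \<in> S"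
  shows "nabla_endo G' (nabla_vec G' xi') x u *v v = bil (G' x) u v *\<^sub>R xi' x - bil (G' x) v (xi' x) *\<^sub>R u"
proof -
  have d: "(\<lambda>y. - \<Phi> y) differentiable (at x)" using diffs(1)[OF assms] by simp
  have "nabla_vec G' xi' differentiable (at x)"
    by (rule differentiable_cong_open[OF open_S assms _ d]) (simp add: nabla_vec_G')
  moreover have "dd (nabla_vec G' xi') x u = - dd \<Phi> x u"
    unfolding dd_minus[OF diffs(1)[OF assms], symmetric]
    by (rule fun_cong[OF dd_cong[OF open_S assms]]) (simp add: nabla_vec_G')
  ultimately have "nabla_endo G' (nabla_vec G' xi') x u *v v =
     - (bil (G x) u v *\<^sub>R \<xi> x) + ((1 - a) * (\<eta> x \<bullet> u) * (\<eta> x \<bullet> v)) *\<^sub>R \<xi> x + (a * (\<eta> x \<bullet> v)) *\<^sub>R u"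
    by (simp add: nabla_endo_apply nabla_vec_G' gam_G' assms neg_matrix_vector_mult mult_vec_simps
      dd_Phi gam_simps Phi_Phi eta_Phi inner_simps) (simp add: algebra_simps)
  moreover have "bil (G' x) u v *\<^sub>R xi' x - bil (G' x) v (xi' x) *\<^sub>R u =
     - (bil (G x) u v *\<^sub>R \<xi> x) + ((1 - a) * (\<eta> x \<bullet> u) * (\<eta> x \<bullet> v)) *\<^sub>R \<xi> x + (a * (\<eta> x \<bullet> v)) *\<^sub>R u"
  proof -
    have *: "bil (G' x) u v * inverse a = - bil (G x) u v + (1 - a) * (\<eta> x \<bullet> u) * (\<eta> x \<bullet> v)"
      using a_neg by (simp add: bil_G' field_simps)
    then show ?thesis unfolding bil_G'_xi'[OF assms] unfolding deformed_field_def scaleR_scaleR * by (simp add: algebra_simps)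
  qed
  ultimately show ?thesis by simp
qed

text \<open>The covariant derivative \<open>- \<Phi>\<close> of \<open>xi'\<close> is skew for
  \<open>G\<close>, and \<eta> vanishes on its image, so it is skew for \<open>G'\<close>.\<close>

lemma lie_deriv_G':
  assumes "x \<in> S"
  shows "lie_deriv_metric xi' G' x = 0"
proof -
  have "xi' differentiable (at x)" by (rule smooth_on_differentiable[OF smooth_xi' assms])
  then show ?thesis
    by (simp add: vec_eq_iff G'.lie_deriv_eq assms nabla_vec_G' neg_matrix_vector_mult bil_simps bil_G'
       eta_Phi Phi_skew)
qed

text \<open>Adding a tensor \<open>D\<close> to a torsion-free connection adds the antisymmetrised
  \<open>\<nabla> D\<close> and the commutator of \<open>D\<close> with itself to the curvature.
  These are the parts linear and quadratic in \<open>1 - a\<close>.\<close>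

lemma riem_G':
  assumes "x \<in> S"
  shows "riem G' x u v w = riem G x u v w
    + (1 - a) *\<^sub>R ((2 * bil (G x) u (\<Phi> x *v v)) *\<^sub>R (\<Phi> x *v w) + bil (G x) u (\<Phi> x *v w) *\<^sub>R (\<Phi> x *v v)
        - bil (G x) v (\<Phi> x *v w) *\<^sub>R (\<Phi> x *v u)
        + ((\<eta> x \<bullet> v) * bil (G x) u w - (\<eta> x \<bullet> u) * bil (G x) v w) *\<^sub>R \<xi> x
        - (2 * (\<eta> x \<bullet> w)) *\<^sub>R ((\<eta> x \<bullet> v) *\<^sub>R u - (\<eta> x \<bullet> u) *\<^sub>R v))
    + ((1 - a)\<^sup>2 * (\<eta> x \<bullet> w)) *\<^sub>R ((\<eta> x \<bullet> v) *\<^sub>R u - (\<eta> x \<bullet> u) *\<^sub>R v)"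
proof -
  define c where "c = 1 - a"
  note gam' = gam_G'[folded c_def]
  have eta: "((\<lambda>y. \<eta> y \<bullet> v) has_derivative (\<lambda>u. dd \<eta> x u \<bullet> v)) (at x)" for v
    by (rule bounded_linear.has_derivative[OF bounded_linear_inner_left has_derivative_dd[OF diffs(3)[OF assms]]])
  have Phi: "((\<lambda>y. \<Phi> y *v v) has_derivative (\<lambda>u. dd \<Phi> x u *v v)) (at x)" for v
    by (rule bounded_linear.has_derivative[OF bounded_linear_mult_vec_left has_derivative_dd[OF diffs(1)[OF assms]]])
  have dd': "dd (\<lambda>y. gam G' y v w) x u = dd (\<lambda>y. gam G y v w) x u
    + c *\<^sub>R ((\<eta> x \<bullet> v) *\<^sub>R (dd \<Phi> x u *v w) + (dd \<eta> x u \<bullet> v) *\<^sub>R (\<Phi> x *v w)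
       + (\<eta> x \<bullet> w) *\<^sub>R (dd \<Phi> x u *v v) + (dd \<eta> x u \<bullet> w) *\<^sub>R (\<Phi> x *v v))" for u v w
  proof -
    have "((\<lambda>y. gam G y v w + c *\<^sub>R ((\<eta> y \<bullet> v) *\<^sub>R (\<Phi> y *v w) + (\<eta> y \<bullet> w) *\<^sub>R (\<Phi> y *v v)))
       has_derivative (\<lambda>u. dd (\<lambda>y. gam G y v w) x u
    + c *\<^sub>R ((\<eta> x \<bullet> v) *\<^sub>R (dd \<Phi> x u *v w) + (dd \<eta> x u \<bullet> v) *\<^sub>R (\<Phi> x *v w)
       + (\<eta> x \<bullet> w) *\<^sub>R (dd \<Phi> x u *v v) + (dd \<eta> x u \<bullet> w) *\<^sub>R (\<Phi> x *v v)))) (at x)"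
      by (rule derivative_eq_intros eta Phi has_derivative_dd[OF diff_gam[OF assms]] refl)+
         (simp add: fun_eq_iff algebra_simps)
    \<comment> \<open>The formula for \<open>gam G'\<close> holds on the whole open set
      \<open>S\<close>, so it may be differentiated at \<open>x\<close>.\<close>
    from dd_eqI[OF this] show ?thesis
      using dd_cong[OF open_S assms, of "\<lambda>y. gam G' y v w"] gam' by (metis (no_types, lifting))
  qed
  have sk: "bil (G x) v (\<Phi> x *v u) = - bil (G x) u (\<Phi> x *v v)"
    using Phi_skew[OF assms, of u v] sym_G[OF assms] by simp
  show ?thesis
    unfolding riem_def dd' c_def[symmetric]
    by (simp add: gam' assms dd_Phi dd_eta gam_simps mult_vec_simps Phi_Phi eta_Phi inner_simps sk
         gam_sym[OF assms, of v u] sym_G[OF assms, of v u])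
       (simp add: vec_eq_iff algebra_simps power2_eq_square)
qed

text \<open>Skewness reads \<open>G \<Phi> = - \<Phi>\<^sup>T G\<close>, so \<Phi> is similar to
  \<open>- \<Phi>\<^sup>T\<close> and its trace equals its own negative.\<close>

lemma trace_Phi:
  assumes "x \<in> S"
  shows "trace (\<Phi> x) = 0"
proof -
  obtain B where B: "G x ** B = mat 1" "B ** G x = mat 1"
    using invertible_G[OF assms] unfolding invertible_def by blast
  have "(G x ** \<Phi> x) *v u = - (transpose (\<Phi> x) ** G x) *v u" for u
  proof -
    have "v \<bullet> ((G x ** \<Phi> x) *v u) = v \<bullet> (- (transpose (\<Phi> x) ** G x) *v u)" for v
      using Phi_skew[OF assms, of v u]
      by (simp add: bil_def matrix_vector_mul_assoc[symmetric] neg_matrix_vector_mult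
        dot_lmul_matrix[symmetric] inner_commute[of v] del: transpose_matrix_vector)
    then show ?thesis using vector_eq_ldot by blast
  qed
  then have "G x ** \<Phi> x = - (transpose (\<Phi> x) ** G x)" by (simp add: matrix_eq)
  moreover have "\<Phi> x = B ** (G x ** \<Phi> x)"
    by (simp add: matrix_mul_assoc B)
  moreover have "B ** (- X) = - (B ** X)" "trace (- X) = - trace X" for X :: "real^'m^'m"
    by (simp_all add: vec_eq_iff matrix_matrix_mult_def trace_def sum_negf)
  ultimately have "trace (\<Phi> x) = - trace (B ** (transpose (\<Phi> x) ** G x))" by metis
  also have "trace (B ** (transpose (\<Phi> x) ** G x)) = trace (transpose (\<Phi> x))"
    by (metis B(1) matrix_mul_assoc matrix_mul_rid trace_mul_sym)
  finally show ?thesis by (simp add: trace_def transpose_def)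
qed

lemma ricci_G':
  assumes "x \<in> S"
  shows "ricci G' x $ j $ l = ricci G x $ j $ l
    + (1 - a) * (2 * G x $ j $ l - 2 * real CARD('m) * (\<eta> x $ j * \<eta> x $ l))
    + (1 - a)\<^sup>2 * (real CARD('m) - 1) * (\<eta> x $ j * \<eta> x $ l)"
proof -
  have tr: "(\<Sum>k\<in>UNIV. (\<Phi> x *v axis k 1) $ k) = 0"
    using trace_Phi[OF assms] by (simp add: trace_def matrix_vector_mult_basis column_def)
  have ax: "\<eta> x \<bullet> axis j 1 = \<eta> x $ j" for j by (simp add: inner_axis)
  have t: "(\<Sum>k\<in>UNIV. (\<eta> x \<bullet> axis k 1) * axis j 1 $ k) = \<eta> x $ j" for j
    by (simp add: sum_inner_axis ax)
  have s: "(\<Sum>k\<in>UNIV. (\<eta> x \<bullet> axis k 1) * \<xi> x $ k) = 1"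
    by (simp add: sum_inner_axis eta_xi assms)
  let ?j = "axis j 1 :: real^'m" and ?l = "axis l 1 :: real^'m"
  \<comment> \<open>The factor 0 is the trace of \<Phi>; the differences with
    \<open>CARD('m)\<close> are traces of the identity minus a rank-one map.\<close>
  have "(\<Sum>k\<in>UNIV. riem G' x (axis k 1) ?j ?l $ k) = (\<Sum>k\<in>UNIV. riem G x (axis k 1) ?j ?l $ k)
    + (1 - a) * (2 * bil (G x) (\<Phi> x *v ?l) (\<Phi> x *v ?j) + bil (G x) (\<Phi> x *v ?j) (\<Phi> x *v ?l)
        - bil (G x) ?j (\<Phi> x *v ?l) * 0
        + (\<eta> x $ j * bil (G x) (\<xi> x) ?l - bil (G x) ?j ?l)
        - 2 * \<eta> x $ l * (\<eta> x $ j * real CARD('m) - \<eta> x $ j))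
    + (1 - a)\<^sup>2 * \<eta> x $ l * (\<eta> x $ j * real CARD('m) - \<eta> x $ j)"
  proof -
    \<comment> \<open>Each summand is arranged to match one trace formula; the factors 1 sum to
      \<open>CARD('m)\<close>.\<close>
    have "riem G' x (axis k 1) ?j ?l $ k = riem G x (axis k 1) ?j ?l $ k
    + (1 - a) * (2 * (bil (G x) (axis k 1) (\<Phi> x *v ?j) * (\<Phi> x *v ?l) $ k)
        + bil (G x) (axis k 1) (\<Phi> x *v ?l) * (\<Phi> x *v ?j) $ k
        - bil (G x) ?j (\<Phi> x *v ?l) * (\<Phi> x *v axis k 1) $ k
        + (\<eta> x $ j * (bil (G x) (axis k 1) ?l * \<xi> x $ k) - bil (G x) ?j ?l * ((\<eta> x \<bullet> axis k 1) * \<xi> x $ k))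
        - 2 * \<eta> x $ l * (\<eta> x $ j * 1 - (\<eta> x \<bullet> axis k 1) * ?j $ k))
    + (1 - a)\<^sup>2 * \<eta> x $ l * (\<eta> x $ j * 1 - (\<eta> x \<bullet> axis k 1) * ?j $ k)" for k
      by (simp add: riem_G' assms ax left_diff_distrib)
    then show ?thesis
      by (simp only: sum.distrib sum_subtractf sum_distrib_left[symmetric] sum_bil_axis tr s t) simp
  qed
  then show ?thesis
    by (simp add: ricci_nth[OF diff_gam[OF assms]] ricci_nth[OF G'.diff_gam[OF assms]] G_Phi_Phi G_xi assms
       ax bil_axis[of _ j l] sym_G[OF assms, of ?l ?j]) (simp add: algebra_simps)
qed

text \<open>Two evaluations of \<open>Ric(\<xi>, \<xi>)\<close> give
  \<open>lam + nu = CARD('m) - 1\<close>. The new coefficient of \<open>G\<close> is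
  \<open>lam + 2 (1 - a) = a (CARD('m) - 1)\<close>, and eliminating \<open>nu\<close> gives
  \<open>a (a - 1) (CARD('m) - 1)\<close> for \<open>\<eta> \<otimes> \<eta>\<close>.\<close>

lemma ricci_G'_einstein:
  assumes "x \<in> S" and ric: "ricci G x = lam *\<^sub>R G x + nu *\<^sub>R outer (\<eta> x)"
    and lam: "lam = a * (real CARD('m) + 1) - 2"
  shows "ricci G' x = - (real CARD('m) - 1) *\<^sub>R G' x"
proof -
  let ?N = "real CARD('m)"
  have "?N - 1 = \<xi> x \<bullet> (ricci G x *v \<xi> x)"
    using eta_xi[OF assms(1)] by (simp add: ricci_xi[OF assms(1)] inner_commute)
  also have "\<dots> = lam + nu"
    unfolding bil_def[symmetric] ric bil_matrix_simps bil_outer by (simp add: G_xi eta_xi assms(1))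
  finally have nu: "nu = ?N - 1 - (a * (?N + 1) - 2)" using lam by simp
  have "ricci G' x $ j $ l = - (?N - 1) * G' x $ j $ l" for j l
  proof -
    have "ricci G x $ j $ l = lam * G x $ j $ l + nu * (\<eta> x $ j * \<eta> x $ l)"
      by (simp add: ric outer_def)
    then show ?thesis
      unfolding ricci_G'[OF assms(1)] nu lam
      by (simp add: deformed_metric_def outer_def) (simp add: algebra_simps power2_eq_square)
  qed
  then show ?thesis by (simp add: vec_eq_iff)
qed

end

section \<open>From charts to the manifold\<close>

lemma sasakian_imp_chart:
  fixes A :: "('a, 'm::finite) chart set"
  assumes "sasakian n M A \<xi> \<eta> \<Phi> g" "c \<in> A"
  shows "sasakian_chart (crange c) (\<xi> c) (\<eta> c) (\<Phi> c) (g c)"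
proof
  show "open (crange c)"
    using assms by (auto simp: sasakian_def smooth_manifold_def is_chart_def)
  show "smooth_on (crange c) (g c)" "smooth_on (crange c) (\<Phi> c)"
    "smooth_on (crange c) (\<xi> c)" "smooth_on (crange c) (\<eta> c)"
    using assms by (auto simp: sasakian_def riemannian_metric_def sym_form_field_def endo_field_def
      vector_field_def contact_form_def one_form_def)
  fix x u v assume "x \<in> crange c"
  then show "bil (g c x) u v = bil (g c x) v u" "u \<noteq> 0 \<Longrightarrow> bil (g c x) u u > 0"
    using assms by (auto simp: sasakian_def riemannian_metric_def sym_form_field_def)
qed (use assms in \<open>auto simp: sasakian_def\<close>)

lemma vector_field_deformed:
  "vector_field A \<xi> \<Longrightarrow> (\<And>c. c \<in> A \<Longrightarrow> open (crange c)) \<Longrightarrow>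
    vector_field A (\<lambda>c. deformed_field a (\<xi> c))"
  unfolding vector_field_def deformed_field_def[abs_def]
  by (auto simp: matrix_vector_mult_scaleR bounded_linear.smooth_on[OF bounded_linear_scaleR_right])

theorem proposition23:
  fixes M :: "'a topology" and A :: "('a, 'm::finite) chart set"
    and \<xi> \<eta> :: "('a, 'm) vfield" and \<Phi> g :: "('a, 'm) mfield"
    and n :: nat and lam nu a :: real
  assumes "sasakian n M A \<xi> \<eta> \<Phi> g"
    and "compact_space M"
    and "quasi_regular M A \<xi>"
    and "eta_einstein A \<eta> g lam nu"
    and "lam < -2"
    and "a = (lam + 2) / (2 + 2 * real n)"
  shows "\<exists>\<xi>' g'. lorentzian_sasakian_einstein n M A \<xi>' g' \<and>
           (\<forall>c\<in>A. \<forall>x\<in>crange c.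
              \<xi>' c x = inverse a *\<^sub>R \<xi> c x \<and>
              - g' c x = a *\<^sub>R g c x + (a * (a - 1)) *\<^sub>R outer (\<eta> c x))"
proof (intro exI conjI)
  let ?g = "\<lambda>c. deformed_metric a (\<eta> c) (g c)" and ?\<xi> = "\<lambda>c. deformed_field a (\<xi> c)"
  \<comment> \<open>This makes the denominator of \<open>a\<close> positive, so \<open>a\<close> has
    the sign of \<open>lam + 2\<close>.\<close>
  have "real n \<ge> 0" by simp
  then have a: "a < 0" "lam = a * (2 + 2 * real n) - 2"
    using assms(5,6) by (auto simp: divide_less_0_iff)
  have N: "CARD('m) = 2 * n + 1" using assms(1) by (simp add: sasakian_def)
  have chart: "deformed_sasakian_chart (crange c) (\<xi> c) (\<eta> c) (\<Phi> c) (g c) a" if "c \<in> A" for c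
    using sasakian_imp_chart[OF assms(1) that] a(1)
    by (simp add: deformed_sasakian_chart_def deformed_sasakian_chart_axioms_def)
  have fields: "vector_field A \<xi>" "one_form A \<eta>" "sym_form_field A g" "smooth_manifold M A"
    using assms(1) by (auto simp: sasakian_def contact_form_def riemannian_metric_def)
  have "sym_form_field A ?g"
    using fields(2,3) deformed_sasakian_chart.smooth_G'[OF chart]
    unfolding sym_form_field_def one_form_def by (simp add: bil_deformed_metric)
  then have lor: "lorentzian_metric A ?g"
    unfolding lorentzian_metric_def
    using deformed_sasakian_chart.nondeg_G'[OF chart] deformed_sasakian_chart.form_index_G'[OF chart]
    by blast
  have "vector_field A ?\<xi>"
    by (rule vector_field_deformed[OF fields(1)])
       (rule sasakian_chart.open_S[OF sasakian_imp_chart[OF assms(1)]])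
  then have kill: "killing_field A ?g ?\<xi>"
    unfolding killing_field_def using deformed_sasakian_chart.lie_deriv_G'[OF chart] by blast
  \<comment> \<open>Here \<open>g'(\<xi>', \<xi>') = - a \<eta>(\<xi>')\<close>, and
    \<open>\<eta>(\<xi>')\<close> is the inverse of \<open>a\<close>.\<close>
  have norm: "bil (?g c x) (?\<xi> c x) (?\<xi> c x) = -1" if "c \<in> A" "x \<in> crange c" for c x
  proof -
    interpret deformed_sasakian_chart "crange c" "\<xi> c" "\<eta> c" "\<Phi> c" "g c" a by (rule chart[OF that(1)])
    show ?thesis
      unfolding bil_G'_xi'[OF that(2)] using a(1) eta_xi[OF that(2)] by (simp add: deformed_field_def)
  qed
  have "lorentzian_sasakian n M A ?\<xi> ?g"
    unfolding lorentzian_sasakian_def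
    using fields(4) N lor kill norm deformed_sasakian_chart.nabla_endo_G'[OF chart] by blast
  \<comment> \<open>As \<open>CARD('m) = 2 * n + 1\<close>, the Einstein constant is
    \<open>- 2 n\<close>, the same in every chart.\<close>
  moreover have "ricci (?g c) x = - (real CARD('m) - 1) *\<^sub>R ?g c x" if "c \<in> A" "x \<in> crange c" for c x
  proof (rule deformed_sasakian_chart.ricci_G'_einstein[OF chart[OF that(1)] that(2)])
    show "ricci (g c) x = lam *\<^sub>R g c x + nu *\<^sub>R outer (\<eta> c x)"
      using assms(4) that by (simp add: eta_einstein_def)
    show "lam = a * (real CARD('m) + 1) - 2" using a(2) N by simp
  qed
  then have "einstein_metric A ?g" unfolding einstein_metric_def by blast
  ultimately show "lorentzian_sasakian_einstein n M A ?\<xi> ?g"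
    by (simp add: lorentzian_sasakian_einstein_def)
qed (simp add: deformed_metric_def deformed_field_def)

end
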